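(* Let $\mu\in\mathbb{R}$, let $\{\alpha_i\}_{i\ge 0}$ and $\{\beta_{i,j}\}_{i\ge 0,\,j\ge 1}$ be arrays of real numbers, and let $Q:\mathbb{R}\to\mathbb{R}$ be a measurable function for which there is a constant $c_Q>0$ with $|Q(x)|\le c_Q|x|$ for all $x\in\mathbb{R}$. Consider the projective equation $$X_t=\mu+\sum_{s\le t}\zeta_s\,Q\Big(\alpha_{t-s}+\sum_{s<u\le t}\beta_{t-u,u-s}\big(\mathrm{E}_{[u,t]}X_t-\mathrm{E}_{[u+1,t]}X_t\big)\Big),\qquad t\in\mathbb{Z}, \qquad ( * )$$ and put $$K_Q:=\sum_{i=0}^\infty\alpha_i^2\sum_{k=0}^\infty c_Q^{2k+2}\sum_{j_1=1}^\infty\beta_{i,j_1}^2\cdots\sum_{j_k=1}^\infty\beta_{i+j_1+\dots+j_{k-1},\,j_k}^2\in[0,\infty]$$ (the $k=0$ term of the sum over $k$ being $c_Q^2$). (i) Assume $K_Q<\infty$. Then there exists a unique solution $\{X_t\}$ of $( * )$. It is a projective moving average $X_t=\mu+\sum_{s\le t}g_{s,t}\zeta_s$ with coefficients defined recursively by $$g_{t,t}:=Q(\alpha_0),\qquad g_{t-k,t}:=Q\Big(\alpha_k+\sum_{i=0}^{k-1}\beta_{i,k-i}\,\zeta_{t-i}\,g_{t-i,t}\Big),\quad k=1,2,\dots.$$ This solution is represented by the nested Volterra series $$X_t=\mu+\sum_{s_1\le t}\zeta_{s_1}G_{s_1}\Big(\sum_{s_1<s_2\le t}\zeta_{s_2}G_{s_1,s_2}\Big(\cdots\zeta_{s_{p-1}}G_{s_1,\dots,s_{p-1}}\Big(\sum_{s_{p-1}<s_p\le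 t}\zeta_{s_p}G_{s_1,\dots,s_p}\Big)\Big)\Big),$$ where, for a finite nonempty set $S\subset(-\infty,t]\cap\mathbb{Z}$, $$G_S(x)=\begin{cases}Q(\alpha_0),&S=\{t\},\\ Q(\alpha_{t-s}+x),&S=\{s\},\ s<t,\\ \beta_{t-s_k,\,s_k-s_{k-1}}\,Q(\alpha_{t-s_k}),&S=\{s_1,\dots,s_k\},\ s_1<\dots<s_k=t,\ k>1,\\ \beta_{t-s_k,\,s_k-s_{k-1}}\,Q(\alpha_{t-s_k}+x),&S=\{s_1,\dots,s_k\},\ s_1<\dots<s_k<t,\ k>1.\end{cases}$$ More explicitly, $$X_t=\mu+Q(\alpha_0)\zeta_t+Q\big(\alpha_1+\beta_{0,1}\zeta_tQ(\alpha_0)\big)\zeta_{t-1}+Q\Big(\alpha_2+\beta_{0,2}\zeta_tQ(\alpha_0)+\beta_{1,1}\zeta_{t-1}Q\big(\alpha_1+\beta_{0,1}\zeta_tQ(\alpha_0)\big)\Big)\zeta_{t-2}+\dots.$$ (ii) In the case of the linear function $Q(x)=c_Qx$, the condition $K_Q<\infty$ is also necessary for the existence of a solution of $( * )$.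
   Context: $\{\zeta_t,\,t\in\mathbb{Z}\}$ is a sequence of i.i.d. real random variables with $\mathrm{E}\zeta_0=0$, $\mathrm{E}\zeta_0^2=1$. For integers $s\le t$, $\mathcal{F}_{[s,t]}:=\sigma\{\zeta_u:u\in[s,t]\}$; for $s>t$, $\mathcal{F}_{[s,t]}$ is the trivial sigma-algebra. $\mathrm{E}_{[s,t]}[\xi]:=\mathrm{E}[\xi\,|\,\mathcal{F}_{[s,t]}]$. $L^2_{(-\infty,t]}$ is the space of square integrable random variables measurable with respect to $\sigma\{\zeta_u:u\le t\}$. A projective process is a random sequence $\{Y_t\in L^2_{(-\infty,t]},\,t\in\mathbb{Z}\}$ of the form $Y_t=\mathrm{E}Y_t+\sum_{s\le t}g_{s,t}\zeta_s$ (mean square convergence), where (i) $g_{s,t}$ is an $\mathcal{F}_{[s+1,t]}$-measurable random variable for $s<t$ and $g_{t,t}$ is a deterministic number; (ii) $\sum_{s\le t}\mathrm{E}g_{s,t}^2<\infty$ for all $t\in\mathbb{Z}$. It is a projective moving average if, in addition, $\mathrm{E}Y_t$ is constant in $t$ and there exist $g_0\in\mathbb{R}$ and nonrandom measurable functions $g_j:\mathbb{R}^j\to\mathbb{R}$, $j\ge1$, with $g_{s,t}=g_{t-s}(\zeta_{s+1},\dots,\zeta_t)$ a.s. for all $s\le t$. A solution of an equation $X_t=\mu+\sum_{s\le t}\zeta_sQ_{s,t}(\cdots)$ such as $( * )$, where $Q_{s,t}(\cdots)$ denotes the expression multiplying $\zeta_s$, is a projective process $\{X_t\}$ such that $\sum_{s\le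 t}\mathrm{E}[Q_{s,t}(\cdots)^2]<\infty$ and the equation holds for every $t\in\mathbb{Z}$. Nested Volterra series here: for a finite nonempty set $S=\{s_1<\dots<s_k\}\subset(-\infty,t]$ with $s_k<t$, the argument of $G_S=G_{s_1,\dots,s_k}$ is the finite sum over $s_{k+1}$ with $s_k<s_{k+1}\le t$ of $\zeta_{s_{k+1}}G_{s_1,\dots,s_{k+1}}(\cdot)$, where the argument of $G_{s_1,\dots,s_{k+1}}$ is defined in the same way; the nesting terminates when the last element equals $t$, since then $G_S$ is a constant. *)

theory Defs
  imports "HOL-Probability.Probability"
begin

(* The sigma-algebra generated by the variables (zeta_u), u in I; trivial for I = {}. *)
definition noise_algebra :: "'a measure \<Rightarrow> (int \<Rightarrow> 'a \<Rightarrow> real) \<Rightarrow> int set \<Rightarrow> 'a measure" where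
  "noise_algebra M \<zeta> I =
     sigma (space M) (\<Union>u\<in>I. {\<zeta> u -` A \<inter> space M | A. A \<in> sets borel})"

definition std_iid :: "'a measure \<Rightarrow> (int \<Rightarrow> 'a \<Rightarrow> real) \<Rightarrow> bool" where
  "std_iid M \<zeta> \<longleftrightarrow>
     prob_space.indep_vars M (\<lambda>_. borel) \<zeta> UNIV \<and>
     (\<forall>t. distr M borel (\<zeta> t) = distr M borel (\<zeta> 0)) \<and>
     has_bochner_integral M (\<zeta> 0) 0 \<and>
     has_bochner_integral M (\<lambda>\<omega>. (\<zeta> 0 \<omega>)\<^sup>2) 1"

(* Y is the mean square sum of f s over s \<le> t.  The Lebesgue integral with values in
   [0,\<infinity>] is used because the Bochner integral of a non-integrable function is 0. *)
definition ms_sum :: "'a measure \<Rightarrow> int \<Rightarrow> (int \<Rightarrow> 'a \<Rightarrow> real) \<Rightarrow> ('a \<Rightarrow> real) \<Rightarrow> bool" where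
  "ms_sum M t f Y \<longleftrightarrow>
     (\<lambda>n. \<integral>\<^sup>+\<omega>. ennreal ((Y \<omega> - (\<Sum>s\<in>{t - int n..t}. f s \<omega>))\<^sup>2) \<partial>M) \<longlonglongrightarrow> 0"

(* The sum over s \<le> t of E (f s)^2, as an element of [0,\<infinity>]. *)
definition sum_second_moments :: "'a measure \<Rightarrow> int \<Rightarrow> (int \<Rightarrow> 'a \<Rightarrow> real) \<Rightarrow> ennreal" where
  "sum_second_moments M t f = (\<Sum>n. \<integral>\<^sup>+\<omega>. ennreal ((f (t - int n) \<omega>)\<^sup>2) \<partial>M)"

(* Y is a projective process with coefficients g s t; only the values of g for s \<le> t matter. *)
definition projective_with_coeffs ::
  "'a measure \<Rightarrow> (int \<Rightarrow> 'a \<Rightarrow> real) \<Rightarrow> (int \<Rightarrow> 'a \<Rightarrow> real) \<Rightarrow> (int \<Rightarrow> int \<Rightarrow> 'a \<Rightarrow> real) \<Rightarrow> bool" where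
  "projective_with_coeffs M \<zeta> Y g \<longleftrightarrow>
     (\<forall>t. Y t \<in> borel_measurable (noise_algebra M \<zeta> {..t}) \<and>
          integrable M (\<lambda>\<omega>. (Y t \<omega>)\<^sup>2) \<and>
          (\<exists>c. \<forall>\<omega>\<in>space M. g t t \<omega> = c) \<and>
          (\<forall>s<t. g s t \<in> borel_measurable (noise_algebra M \<zeta> {s+1..t})) \<and>
          sum_second_moments M t (\<lambda>s. g s t) < \<infinity> \<and>
          ms_sum M t (\<lambda>s \<omega>. g s t \<omega> * \<zeta> s \<omega>) (\<lambda>\<omega>. Y t \<omega> - integral\<^sup>L M (Y t)))"

definition projective_process ::
  "'a measure \<Rightarrow> (int \<Rightarrow> 'a \<Rightarrow> real) \<Rightarrow> (int \<Rightarrow> 'a \<Rightarrow> real) \<Rightarrow> bool" where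
  "projective_process M \<zeta> Y \<longleftrightarrow> (\<exists>g. projective_with_coeffs M \<zeta> Y g)"

(* A point of R^j is a function on {1..j}, with the product sigma-algebra. *)
definition projective_MA_with_coeffs ::
  "'a measure \<Rightarrow> (int \<Rightarrow> 'a \<Rightarrow> real) \<Rightarrow> (int \<Rightarrow> 'a \<Rightarrow> real) \<Rightarrow> (int \<Rightarrow> int \<Rightarrow> 'a \<Rightarrow> real) \<Rightarrow> bool" where
  "projective_MA_with_coeffs M \<zeta> Y g \<longleftrightarrow>
     projective_with_coeffs M \<zeta> Y g \<and>
     (\<exists>m. \<forall>t. integral\<^sup>L M (Y t) = m) \<and>
     (\<exists>(g0::real) (h :: nat \<Rightarrow> (nat \<Rightarrow> real) \<Rightarrow> real).
        (\<forall>j\<ge>1. h j \<in> borel_measurable (\<Pi>\<^sub>M i\<in>{1..j}. borel)) \<and>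
        (\<forall>t. AE \<omega> in M. g t t \<omega> = g0) \<and>
        (\<forall>t. \<forall>s<t. AE \<omega> in M.
            g s t \<omega> = h (nat (t - s)) (\<lambda>i\<in>{1..nat (t - s)}. \<zeta> (s + int i) \<omega>)))"

(* Q_{s,t}: the factor of zeta_s in the projective equation.  Only beta i j with j \<ge> 1 occurs. *)
definition proj_kernel ::
  "'a measure \<Rightarrow> (int \<Rightarrow> 'a \<Rightarrow> real) \<Rightarrow> (real \<Rightarrow> real) \<Rightarrow> (nat \<Rightarrow> real) \<Rightarrow> (nat \<Rightarrow> nat \<Rightarrow> real)
    \<Rightarrow> (int \<Rightarrow> 'a \<Rightarrow> real) \<Rightarrow> int \<Rightarrow> int \<Rightarrow> 'a \<Rightarrow> real" where
  "proj_kernel M \<zeta> Q \<alpha> \<beta> X s t \<omega> =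
     Q (\<alpha> (nat (t - s)) +
        (\<Sum>u\<in>{s<..t}. \<beta> (nat (t - u)) (nat (u - s)) *
           (real_cond_exp M (noise_algebra M \<zeta> {u..t}) (X t) \<omega>
            - real_cond_exp M (noise_algebra M \<zeta> {u+1..t}) (X t) \<omega>)))"

definition projective_solution ::
  "'a measure \<Rightarrow> (int \<Rightarrow> 'a \<Rightarrow> real) \<Rightarrow> (real \<Rightarrow> real) \<Rightarrow> (nat \<Rightarrow> real) \<Rightarrow> (nat \<Rightarrow> nat \<Rightarrow> real)
    \<Rightarrow> real \<Rightarrow> (int \<Rightarrow> 'a \<Rightarrow> real) \<Rightarrow> bool" where
  "projective_solution M \<zeta> Q \<alpha> \<beta> \<mu> X \<longleftrightarrow>
     projective_process M \<zeta> X \<and>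
     (\<forall>t. sum_second_moments M t (\<lambda>s. proj_kernel M \<zeta> Q \<alpha> \<beta> X s t) < \<infinity> \<and>
          ms_sum M t (\<lambda>s \<omega>. \<zeta> s \<omega> * proj_kernel M \<zeta> Q \<alpha> \<beta> X s t \<omega>) (\<lambda>\<omega>. X t \<omega> - \<mu>))"

(* beta_chain beta k i is the iterated sum over j_1,...,j_k \<ge> 1 in K_Q, started at i. *)
fun beta_chain :: "(nat \<Rightarrow> nat \<Rightarrow> real) \<Rightarrow> nat \<Rightarrow> nat \<Rightarrow> ennreal" where
  "beta_chain \<beta> 0 i = 1"
| "beta_chain \<beta> (Suc k) i =
     (\<Sum>j. ennreal ((\<beta> i (Suc j))\<^sup>2) * beta_chain \<beta> k (i + Suc j))"

definition K_Q :: "real \<Rightarrow> (nat \<Rightarrow> real) \<Rightarrow> (nat \<Rightarrow> nat \<Rightarrow> real) \<Rightarrow> ennreal" where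
  "K_Q c \<alpha> \<beta> =
     (\<Sum>i. ennreal ((\<alpha> i)\<^sup>2) * (\<Sum>k. ennreal (c ^ (2 * k + 2)) * beta_chain \<beta> k i))"

(* g_{t-k,t} on the path z of the noise. *)
fun proj_coeff ::
  "(real \<Rightarrow> real) \<Rightarrow> (nat \<Rightarrow> real) \<Rightarrow> (nat \<Rightarrow> nat \<Rightarrow> real) \<Rightarrow> (int \<Rightarrow> real) \<Rightarrow> int \<Rightarrow> nat \<Rightarrow> real" where
  "proj_coeff Q \<alpha> \<beta> z t 0 = Q (\<alpha> 0)"
| "proj_coeff Q \<alpha> \<beta> z t (Suc k) =
     Q (\<alpha> (Suc k) +
        (\<Sum>i\<le>k. \<beta> i (Suc k - i) * z (t - int i) * proj_coeff Q \<alpha> \<beta> z t i))"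

(* G_S(x), for S finite, nonempty and contained in {..t}; s_k = Max S. *)
definition volterra_G ::
  "(real \<Rightarrow> real) \<Rightarrow> (nat \<Rightarrow> real) \<Rightarrow> (nat \<Rightarrow> nat \<Rightarrow> real) \<Rightarrow> int \<Rightarrow> int set \<Rightarrow> real \<Rightarrow> real" where
  "volterra_G Q \<alpha> \<beta> t S x =
     (if S = {t} then Q (\<alpha> 0)
      else if card S = 1 then Q (\<alpha> (nat (t - Max S)) + x)
      else \<beta> (nat (t - Max S)) (nat (Max S - Max (S - {Max S}))) *
           (if Max S = t then Q (\<alpha> (nat (t - Max S)))
            else Q (\<alpha> (nat (t - Max S)) + x)))"

(* The argument of G_S in the nested series on the path z of the noise.  It is an empty
   sum when Max S = t, where G_S does not depend on its argument. *)
function volterra_arg ::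
  "(real \<Rightarrow> real) \<Rightarrow> (nat \<Rightarrow> real) \<Rightarrow> (nat \<Rightarrow> nat \<Rightarrow> real) \<Rightarrow> (int \<Rightarrow> real) \<Rightarrow> int \<Rightarrow> int set \<Rightarrow> real" where
  "volterra_arg Q \<alpha> \<beta> z t S =
     (if finite S \<and> S \<noteq> {} then
        (\<Sum>u\<in>{Max S<..t}.
           z u * volterra_G Q \<alpha> \<beta> t (insert u S) (volterra_arg Q \<alpha> \<beta> z t (insert u S)))
      else 0)"
  by auto
termination
  by (relation "Wellfounded.measure (\<lambda>(Q, \<alpha>, \<beta>, z, t, S). nat (t - Max S))") auto

(* The recursive equation loops as an unconditional rewrite rule. *)
declare volterra_arg.simps [simp del]

end

theory Submission
  imports Defs
begin

text \<open>
  If \<open>X\<close> is the mean square sum of \<open>\<zeta> s * f s\<close> over \<open>s \<le> t\<close> with \<open>f s\<close> depending only on the noise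
  in \<open>(s, t]\<close>, then the terms are orthogonal, and conditioning \<open>X\<close> on the noise in \<open>[u, t]\<close> cuts the
  sum off at \<open>u\<close>. So the increments of the conditional expectations in the projective equation are
  \<open>\<zeta> u * f u\<close>, and the equation turns into the recursion for the coefficients, which therefore
  determines every solution. By orthogonality, the second moments \<open>v k\<close> of the coefficients satisfy
  \<open>v k \<le> c\<^sup>2 * ((\<alpha> k)\<^sup>2 + (\<Sum>i<k. (\<beta> i (k - i))\<^sup>2 * v i))\<close>, with equality for linear \<open>Q\<close>. Unrolled
  along chains of indices and summed over \<open>k\<close>, the right-hand side is \<open>K_Q\<close>; finiteness of \<open>K_Q\<close> thus
  gives a convergent series, and for linear \<open>Q\<close> a solution forces it.
\<close>

subsection \<open>Chain sums and coefficients\<close>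

lemma suminf_swap_ennreal:
  fixes f :: "nat \<Rightarrow> nat \<Rightarrow> ennreal"
  shows "(\<Sum>i. \<Sum>j. f i j) = (\<Sum>j. \<Sum>i. f i j)"
proof -
  have "(\<Sum>i. \<Sum>j. f i j) = (\<Sum>i. \<integral>\<^sup>+j. f i j \<partial>count_space UNIV)"
    by (simp add: nn_integral_count_space_nat)
  also have "\<dots> = (\<integral>\<^sup>+j. (\<Sum>i. f i j) \<partial>count_space UNIV)"
    by (rule nn_integral_suminf[symmetric]) simp
  finally show ?thesis
    by (simp add: nn_integral_count_space_nat)
qed

text \<open>Zeros outside \<open>i < k\<close> make this a full double series; after the interchange
  the index \<open>k\<close> is written as \<open>i + Suc j\<close>, so that \<open>j\<close> starts
  at 0 as in \<open>beta_chain\<close>.\<close>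

lemma suminf_triangle_ennreal:
  fixes f :: "nat \<Rightarrow> nat \<Rightarrow> ennreal"
  shows "(\<Sum>k. \<Sum>i<k. f i k) = (\<Sum>i. \<Sum>j. f i (i + Suc j))"
proof -
  have "(\<Sum>i<k. f i k) = (\<Sum>i. if i < k then f i k else 0)" for k
    by (subst suminf_finite[of "{..<k}"]) auto
  then have "(\<Sum>k. \<Sum>i<k. f i k) = (\<Sum>i. \<Sum>k. if i < k then f i k else 0)"
    by (simp add: suminf_swap_ennreal[of "\<lambda>k i. if i < k then f i k else 0"])
  moreover have "(\<Sum>k. if i < k then f i k else 0) = (\<Sum>j. f i (i + Suc j))" for i
    by (subst suminf_offset[where i = "Suc i"]) (auto simp: add.commute)
  ultimately show ?thesis
    by simp
qed

section \<open>Weights of index chains and the series \<open>K_Q\<close>\<close>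

text \<open>The contribution of the chains with \<open>m\<close> links to the recursive bound for the second
  moment of the \<open>k\<close>-th coefficient.\<close>

fun chain_weight :: "real \<Rightarrow> (nat \<Rightarrow> real) \<Rightarrow> (nat \<Rightarrow> nat \<Rightarrow> real) \<Rightarrow> nat \<Rightarrow> nat \<Rightarrow> ennreal" where
  "chain_weight c \<alpha> \<beta> 0 k = ennreal (c\<^sup>2) * ennreal ((\<alpha> k)\<^sup>2)"
| "chain_weight c \<alpha> \<beta> (Suc m) k =
     ennreal (c\<^sup>2) * (\<Sum>i<k. ennreal ((\<beta> i (k - i))\<^sup>2) * chain_weight c \<alpha> \<beta> m i)"

text \<open>\<open>chain_weight\<close> grows by a link at the end of a chain and
  \<open>beta_chain\<close> by a link at its start. Each induction step moves the link from
  \<open>i\<close> to \<open>k\<close> out of the former into the latter, which is why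
  \<open>l\<close> is arbitrary.\<close>

lemma suminf_chain_weight_beta_chain:
  "(\<Sum>k. chain_weight c \<alpha> \<beta> m k * beta_chain \<beta> l k) =
     ennreal (c ^ (2 * m + 2)) * (\<Sum>i. ennreal ((\<alpha> i)\<^sup>2) * beta_chain \<beta> (m + l) i)"
proof (induction m arbitrary: l)
  case 0
  then show ?case
    by (simp add: mult.assoc power2_eq_square)
next
  case (Suc m)
  let ?W = "chain_weight c \<alpha> \<beta>"
  have "(\<Sum>k. ?W (Suc m) k * beta_chain \<beta> l k) =
      ennreal (c\<^sup>2) * (\<Sum>k. \<Sum>i<k. ennreal ((\<beta> i (k - i))\<^sup>2) * ?W m i * beta_chain \<beta> l k)"
    by (simp add: mult.assoc sum_distrib_right)
  also have "\<dots> = ennreal (c\<^sup>2) *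
      (\<Sum>i. \<Sum>j. ennreal ((\<beta> i (Suc j))\<^sup>2) * ?W m i * beta_chain \<beta> l (i + Suc j))"
    by (subst suminf_triangle_ennreal) simp
  also have "\<dots> = ennreal (c\<^sup>2) * (\<Sum>i. ?W m i * beta_chain \<beta> (Suc l) i)"
    by (simp add: mult_ac flip: ennreal_suminf_cmult)
  also have "\<dots> = ennreal (c\<^sup>2) * ennreal (c ^ (2 * m + 2)) *
      (\<Sum>i. ennreal ((\<alpha> i)\<^sup>2) * beta_chain \<beta> (m + Suc l) i)"
    by (simp only: Suc.IH mult.assoc)
  also have "ennreal (c\<^sup>2) * ennreal (c ^ (2 * m + 2)) = ennreal (c ^ (2 * Suc m + 2))"
  proof -
    have "c ^ (2 * Suc m + 2) = c\<^sup>2 * c ^ (2 * m + 2)"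
      by (simp add: power2_eq_square)
    \<comment> \<open>The even exponents make both factors nonnegative for \<open>c\<close> of
      either sign, as \<open>ennreal_mult\<close> requires.\<close>
    moreover have "0 \<le> c ^ (2 * m + 2)"
      by (rule zero_le_even_power) simp
    ultimately show ?thesis
      by (simp only: ennreal_mult zero_le_power2)
  qed
  finally show ?case
    by simp
qed

text \<open>\<open>K_Q\<close> sorts the chains by their first index, the right-hand side by their
  last; the case \<open>l = 0\<close> of the preceding lemma converts one into the other for each
  number of links.\<close>

lemma K_Q_eq_suminf_chain_weight:
  "K_Q c \<alpha> \<beta> = (\<Sum>k. \<Sum>m. chain_weight c \<alpha> \<beta> m k)"
proof -
  have "K_Q c \<alpha> \<beta> =
      (\<Sum>i. \<Sum>m. ennreal (c ^ (2 * m + 2)) * (ennreal ((\<alpha> i)\<^sup>2) * beta_chain \<beta> m i))"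
    by (simp add: K_Q_def mult_ac flip: ennreal_suminf_cmult)
  also have "\<dots> = (\<Sum>m. \<Sum>k. chain_weight c \<alpha> \<beta> m k)"
    by (subst suminf_swap_ennreal) (simp add: suminf_chain_weight_beta_chain[where l = 0, simplified])
  finally show ?thesis
    by (simp add: suminf_swap_ennreal[of "chain_weight c \<alpha> \<beta>"])
qed

text \<open>A chain ending at \<open>k\<close> is either \<open>k\<close> alone or a chain ending at
  some \<open>i < k\<close> followed by one link. The total weight therefore satisfies the moment
  recursion with equality.\<close>

lemma suminf_chain_weight_rec:
  "(\<Sum>m. chain_weight c \<alpha> \<beta> m k) = ennreal (c\<^sup>2) * (ennreal ((\<alpha> k)\<^sup>2) +
     (\<Sum>i<k. ennreal ((\<beta> i (k - i))\<^sup>2) * (\<Sum>m. chain_weight c \<alpha> \<beta> m i)))"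
proof -
  have "(\<Sum>m. chain_weight c \<alpha> \<beta> m k) = (\<Sum>m. chain_weight c \<alpha> \<beta> (Suc m) k) + chain_weight c \<alpha> \<beta> 0 k"
    by (subst suminf_offset[where i = 1]) auto
  also have "(\<Sum>m. chain_weight c \<alpha> \<beta> (Suc m) k) =
      ennreal (c\<^sup>2) * (\<Sum>i<k. \<Sum>m. ennreal ((\<beta> i (k - i))\<^sup>2) * chain_weight c \<alpha> \<beta> m i)"
    by (simp add: suminf_sum)
  finally show ?thesis
    by (simp add: distrib_left add.commute)
qed

text \<open>Comparison principle: the recursion has nonnegative coefficients and refers only to
  smaller indices, so by strong induction \<open>v\<close> stays below the total chain
  weight.\<close>

lemma suminf_le_K_Q:
  fixes v :: "nat \<Rightarrow> real"
  assumes "\<And>k. v k \<ge> 0"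
    and "\<And>k. v k \<le> c\<^sup>2 * ((\<alpha> k)\<^sup>2 + (\<Sum>i<k. (\<beta> i (k - i))\<^sup>2 * v i))"
  shows "(\<Sum>k. ennreal (v k)) \<le> K_Q c \<alpha> \<beta>"
proof -
  have "ennreal (v k) \<le> (\<Sum>m. chain_weight c \<alpha> \<beta> m k)" for k
  proof (induction k rule: less_induct)
    case (less k)
    have "ennreal (v k) \<le> ennreal (c\<^sup>2 * ((\<alpha> k)\<^sup>2 + (\<Sum>i<k. (\<beta> i (k - i))\<^sup>2 * v i)))"
      by (rule ennreal_leI) (rule assms)
    also have "\<dots> = ennreal (c\<^sup>2) * (ennreal ((\<alpha> k)\<^sup>2) +
        (\<Sum>i<k. ennreal ((\<beta> i (k - i))\<^sup>2) * ennreal (v i)))"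
      by (simp add: assms ennreal_mult ennreal_plus sum_nonneg flip: sum_ennreal)
    also have "\<dots> \<le> (\<Sum>m. chain_weight c \<alpha> \<beta> m k)"
      unfolding suminf_chain_weight_rec[of c \<alpha> \<beta> k]
      by (intro mult_left_mono add_left_mono sum_mono less) auto
    finally show ?case .
  qed
  then show ?thesis
    unfolding K_Q_eq_suminf_chain_weight by (intro suminf_le) auto
qed

text \<open>With equality in the recursion the same induction identifies \<open>v\<close> with the
  chain weight. A finite left-hand side then forces \<open>K_Q\<close> to be finite, which is the
  route to necessity for linear \<open>Q\<close>.\<close>

lemma suminf_eq_K_Q:
  fixes v :: "nat \<Rightarrow> real"
  assumes "\<And>k. v k \<ge> 0"
    and "\<And>k. v k = c\<^sup>2 * ((\<alpha> k)\<^sup>2 + (\<Sum>i<k. (\<beta> i (k - i))\<^sup>2 * v i))"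
  shows "(\<Sum>k. ennreal (v k)) = K_Q c \<alpha> \<beta>"
proof -
  have "ennreal (v k) = (\<Sum>m. chain_weight c \<alpha> \<beta> m k)" for k
  proof (induction k rule: less_induct)
    case (less k)
    have "ennreal (v k) = ennreal (c\<^sup>2 * ((\<alpha> k)\<^sup>2 + (\<Sum>i<k. (\<beta> i (k - i))\<^sup>2 * v i)))"
      using assms(2) by metis
    also have "\<dots> = ennreal (c\<^sup>2) * (ennreal ((\<alpha> k)\<^sup>2) +
        (\<Sum>i<k. ennreal ((\<beta> i (k - i))\<^sup>2) * ennreal (v i)))"
      by (simp add: assms(1) ennreal_mult ennreal_plus sum_nonneg flip: sum_ennreal)
    also have "\<dots> = (\<Sum>m. chain_weight c \<alpha> \<beta> m k)"
      by (subst suminf_chain_weight_rec) (simp add: less)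
    finally show ?case .
  qed
  then show ?thesis
    by (simp add: K_Q_eq_suminf_chain_weight)
qed

section \<open>The coefficients as functions of the noise path\<close>

lemma proj_coeff_rec:
  "proj_coeff Q \<alpha> \<beta> z t n =
     Q (\<alpha> n + (\<Sum>i<n. z (t - int i) * (\<beta> i (n - i) * proj_coeff Q \<alpha> \<beta> z t i)))"
  by (cases n) (simp_all add: lessThan_Suc_atMost mult_ac)

text \<open>The coefficient at lag \<open>n\<close> reads only the noise at \<open>t\<close>, ...,
  \<open>t - n + 1\<close>, and only through the distance to \<open>t\<close>. Letting
  \<open>t\<close> vary along with the path gives the shift invariance behind the moving average
  form.\<close>

lemma proj_coeff_cong:
  assumes "\<And>i. i < n \<Longrightarrow> z (t - int i) = z' (t' - int i)"
  shows "proj_coeff Q \<alpha> \<beta> z t n = proj_coeff Q \<alpha> \<beta> z' t' n"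
  using assms
proof (induction n rule: less_induct)
  case (less n)
  then show ?case
    by (subst (1 2) proj_coeff_rec) (intro arg_cong[of _ _ Q] arg_cong2[of _ _ _ _ "(+)"] sum.cong; simp)
qed

text \<open>The sigma-algebra \<open>N\<close> is left abstract because the lemma serves twice: for
  the noise algebras on \<open>M\<close> and for the product sigma-algebra over
  \<open>{1..j}\<close>.\<close>

lemma measurable_proj_coeff:
  assumes [measurable]: "Q \<in> borel_measurable borel"
    and "\<And>i. i < n \<Longrightarrow> (\<lambda>\<omega>. z \<omega> (t - int i)) \<in> borel_measurable N"
  shows "(\<lambda>\<omega>. proj_coeff Q \<alpha> \<beta> (z \<omega>) t n) \<in> borel_measurable N"
  using assms(2)
proof (induction n rule: less_induct)
  case (less n)
  have [measurable]: "(\<lambda>\<omega>. proj_coeff Q \<alpha> \<beta> (z \<omega>) t i) \<in> borel_measurable N"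
    "(\<lambda>\<omega>. z \<omega> (t - int i)) \<in> borel_measurable N" if "i \<in> {..<n}" for i
    using less that by auto
  show ?case
    by (subst proj_coeff_rec) measurable
qed

lemma sum_proj_coeff_3:
  "(\<Sum>i<3. proj_coeff Q \<alpha> \<beta> z t i * z (t - int i)) =
     Q (\<alpha> 0) * z t
     + Q (\<alpha> 1 + \<beta> 0 1 * z t * Q (\<alpha> 0)) * z (t - 1)
     + Q (\<alpha> 2 + \<beta> 0 2 * z t * Q (\<alpha> 0)
          + \<beta> 1 1 * z (t - 1) * Q (\<alpha> 1 + \<beta> 0 1 * z t * Q (\<alpha> 0))) * z (t - 2)"
  by (simp add: eval_nat_numeral add.assoc)

section \<open>From times to lags; the nested Volterra series\<close>

lemma sum_past_reindex:
  fixes f :: "int \<Rightarrow> 'b::comm_monoid_add"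
  shows "(\<Sum>s\<in>{t - int n<..t}. f s) = (\<Sum>i<n. f (t - int i))"
  by (rule sum.reindex_bij_witness[of _ "\<lambda>i. t - int i" "\<lambda>s. nat (t - s)"]) auto

text \<open>A set with at least two elements enters \<open>volterra_G\<close> only through its two
  largest members, here \<open>u\<close> and \<open>Max S\<close>. This makes the nested series
  collapse to a recursion in one index.\<close>

lemma volterra_G_insert:
  assumes "finite S" "S \<noteq> {}" "Max S < u" "u \<le> t"
  shows "volterra_G Q \<alpha> \<beta> t (insert u S) x = \<beta> (nat (t - u)) (nat (u - Max S)) *
    (if u = t then Q (\<alpha> (nat (t - u))) else Q (\<alpha> (nat (t - u)) + x))"
proof -
  have u: "u \<notin> S" "\<And>v. v \<in> S \<Longrightarrow> v < u"
    using assms Max_ge[of S] by force+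
  then have "card (insert u S) \<noteq> 1" "insert u S \<noteq> {t}"
    using assms by (auto simp: card_gt_0_iff) 
  moreover have "Max (insert u S) = u"
    using assms by (simp add: Max_insert)
  moreover have "insert u S - {u} = S"
    using u by simp
  ultimately show ?thesis
    by (cases "u = t") (simp_all add: volterra_G_def del: Max_insert)
qed

lemma sum_kernel_reindex:
  fixes t :: int and f :: "int \<Rightarrow> real"
  assumes "s \<le> t"
  shows "(\<Sum>u\<in>{s<..t}. f u * (\<beta> (nat (t - u)) (nat (u - s)) * g (nat (t - u)))) =
    (\<Sum>i<nat (t - s). f (t - int i) * (\<beta> i (nat (t - s) - i) * g i))"
proof -
  define n where "n = nat (t - s)"
  then have s: "s = t - int n"
    using assms by simp
  have "nat (t - int i - (t - int n)) = n - i" for i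
    by linarith
  then show ?thesis
    unfolding s sum_past_reindex by simp
qed

text \<open>Induction on the distance from \<open>Max S\<close> to \<open>t\<close>. For
  \<open>u\<close> above \<open>Max S\<close>, the inner argument is by induction the sum inside
  \<open>Q\<close> in the recursion at lag \<open>t - u\<close>, so \<open>volterra_G\<close> yields
  the coefficient at that lag times a factor \<beta>.\<close>

lemma volterra_arg_eq_proj_coeff:
  assumes "finite S" "S \<noteq> {}" "Max S \<le> t"
  shows "volterra_arg Q \<alpha> \<beta> z t S =
    (\<Sum>u\<in>{Max S<..t}. z u * (\<beta> (nat (t - u)) (nat (u - Max S)) *
       proj_coeff Q \<alpha> \<beta> z t (nat (t - u))))"
  using assms
proof (induction "nat (t - Max S)" arbitrary: S rule: less_induct)
  case less
  have "volterra_G Q \<alpha> \<beta> t (insert u S) (volterra_arg Q \<alpha> \<beta> z t (insert u S)) =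
      \<beta> (nat (t - u)) (nat (u - Max S)) * proj_coeff Q \<alpha> \<beta> z t (nat (t - u))"
    if u: "u \<in> {Max S<..t}" for u
  proof -
    have Max: "Max (insert u S) = u"
      using less.prems u by (simp add: Max_insert)
    then have "volterra_arg Q \<alpha> \<beta> z t (insert u S) =
        (\<Sum>v\<in>{u<..t}. z v * (\<beta> (nat (t - v)) (nat (v - u)) *
           proj_coeff Q \<alpha> \<beta> z t (nat (t - v))))"
      using less.hyps[of "insert u S", unfolded Max] less.prems(1) u by auto
    also have "\<dots> = (\<Sum>i<nat (t - u). z (t - int i) *
        (\<beta> i (nat (t - u) - i) * proj_coeff Q \<alpha> \<beta> z t i))"
      using u by (intro sum_kernel_reindex) simp
    finally have "volterra_arg Q \<alpha> \<beta> z t (insert u S) = \<dots>" .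
    \<comment> \<open>For \<open>u = t\<close> that sum is empty, so the branch without an argument
      agrees with the recursion as well.\<close>
    then show ?thesis
      using less.prems u
      by (subst proj_coeff_rec) (auto simp: volterra_G_insert)
  qed
  then show ?case
    using less.prems by (subst volterra_arg.simps) simp
qed

text \<open>A singleton carries no factor \<beta>, so the outermost level of the nested series is
  the coefficient itself.\<close>

lemma volterra_G_eq_proj_coeff:
  assumes "s \<le> t"
  shows "volterra_G Q \<alpha> \<beta> t {s} (volterra_arg Q \<alpha> \<beta> z t {s}) = proj_coeff Q \<alpha> \<beta> z t (nat (t - s))"
proof -
  have "volterra_arg Q \<alpha> \<beta> z t {s} =
      (\<Sum>v\<in>{s<..t}. z v * (\<beta> (nat (t - v)) (nat (v - s)) *
         proj_coeff Q \<alpha> \<beta> z t (nat (t - v))))"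
    using assms by (simp add: volterra_arg_eq_proj_coeff)
  also have "\<dots> = (\<Sum>i<nat (t - s). z (t - int i) *
      (\<beta> i (nat (t - s) - i) * proj_coeff Q \<alpha> \<beta> z t i))"
    using assms by (rule sum_kernel_reindex)
  finally have "volterra_arg Q \<alpha> \<beta> z t {s} = \<dots>" .
  then show ?thesis
    by (subst proj_coeff_rec) (auto simp: volterra_G_def)
qed

subsection \<open>Orthogonality of the noise terms\<close>

lemma space_noise_algebra [simp]: "space (noise_algebra M \<zeta> I) = space M"
  unfolding noise_algebra_def by (rule space_measure_of) auto

lemma sets_noise_algebra:
  "sets (noise_algebra M \<zeta> I) =
     sigma_sets (space M) (\<Union>u\<in>I. {\<zeta> u -` A \<inter> space M | A. A \<in> sets borel})"
  unfolding noise_algebra_def by (rule sets_measure_of) auto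

lemma subalgebra_noise_algebra_mono:
  "I \<subseteq> J \<Longrightarrow> subalgebra (noise_algebra M \<zeta> J) (noise_algebra M \<zeta> I)"
  unfolding subalgebra_def sets_noise_algebra by (auto intro!: sigma_sets_mono')

lemma borel_measurable_noise_algebra_mono:
  "f \<in> borel_measurable (noise_algebra M \<zeta> I) \<Longrightarrow> I \<subseteq> J \<Longrightarrow>
     f \<in> borel_measurable (noise_algebra M \<zeta> J)"
  using measurable_from_subalg subalgebra_noise_algebra_mono by blast

lemma borel_measurable_noise_algebra:
  "u \<in> I \<Longrightarrow> \<zeta> u \<in> borel_measurable (noise_algebra M \<zeta> I)"
  by (rule measurableI) (auto simp: sets_noise_algebra)

locale iid_noise = prob_space M for M :: "'a measure" and \<zeta> :: "int \<Rightarrow> 'a \<Rightarrow> real" +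
  assumes std_iid: "std_iid M \<zeta>"
begin

abbreviation F :: "int set \<Rightarrow> 'a measure" where
  "F \<equiv> noise_algebra M \<zeta>"

lemma indep_vars_noise: "indep_vars (\<lambda>_. borel) \<zeta> UNIV"
  using std_iid unfolding std_iid_def by blast

lemma noise_measurable [measurable]: "\<zeta> u \<in> borel_measurable M"
  using indep_vars_noise by (auto simp: indep_vars_def2)

lemma subalgebra_F: "subalgebra M (F I)"
  unfolding subalgebra_def sets_noise_algebra by (auto intro!: sets.sigma_sets_subset)

lemma F_measurable_M: "f \<in> borel_measurable (F I) \<Longrightarrow> f \<in> borel_measurable M"
  using measurable_from_subalg subalgebra_F by blast

lemma sigma_finite_subalgebra_F: "sigma_finite_subalgebra M (F I)"
  by (intro finite_measure_subalgebra_is_sigma_finite finite_measure_subalgebra.intro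
      finite_measure_axioms finite_measure_subalgebra_axioms.intro subalgebra_F)

section \<open>Moments and independence of the noise\<close>

lemma noise_integral_transfer:
  assumes [measurable]: "h \<in> borel_measurable borel"
  shows "integrable M (\<lambda>\<omega>. h (\<zeta> s \<omega>) :: real) \<longleftrightarrow> integrable M (\<lambda>\<omega>. h (\<zeta> 0 \<omega>))"
    and "integral\<^sup>L M (\<lambda>\<omega>. h (\<zeta> s \<omega>) :: real) = integral\<^sup>L M (\<lambda>\<omega>. h (\<zeta> 0 \<omega>))"
proof -
  have *: "distr M borel (\<zeta> s) = distr M borel (\<zeta> 0)"
    using std_iid unfolding std_iid_def by blast
  show "integrable M (\<lambda>\<omega>. h (\<zeta> s \<omega>)) \<longleftrightarrow> integrable M (\<lambda>\<omega>. h (\<zeta> 0 \<omega>))"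
    using arg_cong[OF *, of "\<lambda>N. integrable N h"] by (simp add: integrable_distr_eq)
  show "integral\<^sup>L M (\<lambda>\<omega>. h (\<zeta> s \<omega>)) = integral\<^sup>L M (\<lambda>\<omega>. h (\<zeta> 0 \<omega>))"
    using arg_cong[OF *, of "\<lambda>N. integral\<^sup>L N h"] by (simp add: integral_distr)
qed

lemma noise_moments:
  shows "integrable M (\<zeta> s)" "expectation (\<zeta> s) = 0"
    and "integrable M (\<lambda>\<omega>. (\<zeta> s \<omega>)\<^sup>2)" "expectation (\<lambda>\<omega>. (\<zeta> s \<omega>)\<^sup>2) = 1"
proof -
  have "has_bochner_integral M (\<zeta> 0) 0" "has_bochner_integral M (\<lambda>\<omega>. (\<zeta> 0 \<omega>)\<^sup>2) 1"
    using std_iid unfolding std_iid_def by blast+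
  then show "integrable M (\<zeta> s)" "expectation (\<zeta> s) = 0"
    "integrable M (\<lambda>\<omega>. (\<zeta> s \<omega>)\<^sup>2)" "expectation (\<lambda>\<omega>. (\<zeta> s \<omega>)\<^sup>2) = 1"
    using noise_integral_transfer[of "\<lambda>x. x" s] noise_integral_transfer[of "\<lambda>x. x\<^sup>2" s]
    by (auto simp: has_bochner_integral_iff)
qed

text \<open>Disjoint blocks of an independent family generate independent sigma-algebras; the one
  generated by \<open>Y\<close> lies inside that of the block \<open>I\<close>.\<close>

lemma indep_var_noise:
  assumes "s \<notin> I" "Y \<in> borel_measurable (F I)"
  shows "indep_var borel (\<zeta> s) borel Y"
proof -
  let ?E = "\<lambda>i. {\<zeta> i -` A \<inter> space M |A. A \<in> sets borel}"
  \<comment> \<open>The two blocks are indexed by \<open>bool\<close>: \<open>True\<close> stands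
    for \<open>{s}\<close> and \<open>False\<close> for \<open>I\<close>.\<close>
  have "indep_sets ?E (\<Union>b\<in>UNIV. case_bool {s} I b)"
    by (rule indep_sets_mono_index[of _ UNIV])
      (use indep_vars_noise in \<open>auto simp: indep_vars_def2\<close>)
  then have "indep_sets (\<lambda>b. sigma_sets (space M) (\<Union>i\<in>case_bool {s} I b. ?E i)) UNIV"
  proof (rule indep_sets_collect_sigma)
    show "Int_stable (?E i)" for i
    proof (rule Int_stableI)
      fix a b assume "a \<in> ?E i" "b \<in> ?E i"
      then obtain A B where "A \<in> sets borel" "B \<in> sets borel"
        "a = \<zeta> i -` A \<inter> space M" "b = \<zeta> i -` B \<inter> space M"
        by auto
      then show "a \<inter> b \<in> ?E i"
        by (intro CollectI exI[of _ "A \<inter> B"]) auto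
    qed
    show "disjoint_family_on (case_bool {s} I) UNIV"
      using assms(1) by (auto simp: disjoint_family_on_def split: bool.splits)
  qed
  then have "indep_sets (case_bool
      (sigma_sets (space M) {\<zeta> s -` A \<inter> space M |A. A \<in> sets borel})
      (sigma_sets (space M) {Y -` A \<inter> space M |A. A \<in> sets borel})) UNIV"
  proof (rule indep_sets_mono_sets)
    have "{Y -` A \<inter> space M |A. A \<in> sets borel} \<subseteq> sets (F I)"
      using measurable_sets[OF assms(2)] by auto
    then have "sigma_sets (space M) {Y -` A \<inter> space M |A. A \<in> sets borel} \<subseteq> sets (F I)"
      using sets.sigma_sets_subset[of _ "F I"] by simp
    then show "case_bool (sigma_sets (space M) {\<zeta> s -` A \<inter> space M |A. A \<in> sets borel})
        (sigma_sets (space M) {Y -` A \<inter> space M |A. A \<in> sets borel}) b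
        \<subseteq> sigma_sets (space M) (\<Union>i\<in>case_bool {s} I b. ?E i)" for b
      by (cases b) (simp_all add: sets_noise_algebra)
  qed
  then show ?thesis
    unfolding indep_var_eq indep_set_def using F_measurable_M[OF assms(2)] by simp
qed

section \<open>Square integrable functions of a block of noise\<close>

definition L2 :: "int set \<Rightarrow> ('a \<Rightarrow> real) \<Rightarrow> bool" where
  "L2 I Y \<longleftrightarrow> Y \<in> borel_measurable (F I) \<and> integrable M (\<lambda>\<omega>. (Y \<omega>)\<^sup>2)"

lemma L2_measurable: "L2 I Y \<Longrightarrow> Y \<in> borel_measurable M"
  by (auto simp: L2_def F_measurable_M)

lemma integrable_mult_squares:
  fixes X Y :: "'a \<Rightarrow> real"
  assumes [measurable]: "X \<in> borel_measurable M" "Y \<in> borel_measurable M"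
    and "integrable M (\<lambda>\<omega>. (X \<omega>)\<^sup>2)" "integrable M (\<lambda>\<omega>. (Y \<omega>)\<^sup>2)"
  shows "integrable M (\<lambda>\<omega>. X \<omega> * Y \<omega>)"
proof (rule Bochner_Integration.integrable_bound)
  show "integrable M (\<lambda>\<omega>. (X \<omega>)\<^sup>2 + (Y \<omega>)\<^sup>2)"
    using assms by simp
  show "AE \<omega> in M. norm (X \<omega> * Y \<omega>) \<le> norm ((X \<omega>)\<^sup>2 + (Y \<omega>)\<^sup>2)"
  proof (rule AE_I2)
    fix \<omega>
    have "2 * (\<bar>X \<omega>\<bar> * \<bar>Y \<omega>\<bar>) \<le> (X \<omega>)\<^sup>2 + (Y \<omega>)\<^sup>2"
      using sum_squares_bound[of "\<bar>X \<omega>\<bar>" "\<bar>Y \<omega>\<bar>"] by simp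
    moreover have "0 \<le> \<bar>X \<omega>\<bar> * \<bar>Y \<omega>\<bar>"
      by simp
    ultimately show "norm (X \<omega> * Y \<omega>) \<le> norm ((X \<omega>)\<^sup>2 + (Y \<omega>)\<^sup>2)"
      unfolding real_norm_def abs_mult by linarith
  qed
qed simp

lemma integrable_square_add:
  fixes X Y :: "'a \<Rightarrow> real"
  assumes [measurable]: "X \<in> borel_measurable M" "Y \<in> borel_measurable M"
    and "integrable M (\<lambda>\<omega>. (X \<omega>)\<^sup>2)" "integrable M (\<lambda>\<omega>. (Y \<omega>)\<^sup>2)"
  shows "integrable M (\<lambda>\<omega>. (X \<omega> + Y \<omega>)\<^sup>2)"
  using assms integrable_mult_squares[OF assms] by (simp add: power2_sum mult.assoc)

text \<open>This is nonnegativity of the variance.\<close>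

lemma square_expectation_le:
  fixes X :: "'a \<Rightarrow> real"
  assumes [measurable]: "X \<in> borel_measurable M" and "integrable M (\<lambda>\<omega>. (X \<omega>)\<^sup>2)"
  shows "(expectation X)\<^sup>2 \<le> expectation (\<lambda>\<omega>. (X \<omega>)\<^sup>2)"
proof -
  have "integrable M X"
    using square_integrable_imp_integrable assms by blast
  then show ?thesis
    using variance_positive[of X] variance_eq[of X] assms(2) by linarith
qed

lemma L2_mono: "L2 I Y \<Longrightarrow> I \<subseteq> J \<Longrightarrow> L2 J Y"
  by (auto simp: L2_def borel_measurable_noise_algebra_mono)

lemma L2_add: "L2 I X \<Longrightarrow> L2 I Y \<Longrightarrow> L2 I (\<lambda>\<omega>. X \<omega> + Y \<omega>)"
  unfolding L2_def by (auto intro!: integrable_square_add F_measurable_M)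

lemma L2_cmult: "L2 I X \<Longrightarrow> L2 I (\<lambda>\<omega>. c * X \<omega>)"
  unfolding L2_def by (auto simp: power_mult_distrib)

lemma L2_const: "L2 I (\<lambda>\<omega>. c)"
  unfolding L2_def by simp

text \<open>By independence the expectation factorizes, and \<open>\<zeta> s\<close> has mean zero.
  All orthogonality below comes from this.\<close>

lemma expectation_noise_mult:
  assumes "s \<notin> I" "Y \<in> borel_measurable (F I)" "integrable M Y"
  shows "integrable M (\<lambda>\<omega>. \<zeta> s \<omega> * Y \<omega>)" "expectation (\<lambda>\<omega>. \<zeta> s \<omega> * Y \<omega>) = 0"
  using indep_var_integrable[OF indep_var_noise[OF assms(1,2)] noise_moments(1) assms(3)]
    indep_var_lebesgue_integral[OF indep_var_noise[OF assms(1,2)] noise_moments(1) assms(3)]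
  by (simp_all add: noise_moments(2))

text \<open>The squares are independent too and \<open>\<zeta> s\<close> has second moment 1, so
  multiplication by \<open>\<zeta> s\<close> preserves the L2 norm of variables that depend on other
  noise.\<close>

lemma expectation_noise_mult_square:
  assumes "s \<notin> I" "L2 I Y"
  shows "integrable M (\<lambda>\<omega>. (\<zeta> s \<omega> * Y \<omega>)\<^sup>2)"
    "expectation (\<lambda>\<omega>. (\<zeta> s \<omega> * Y \<omega>)\<^sup>2) = expectation (\<lambda>\<omega>. (Y \<omega>)\<^sup>2)"
proof -
  have *: "indep_var borel (\<lambda>\<omega>. (\<zeta> s \<omega>)\<^sup>2) borel (\<lambda>\<omega>. (Y \<omega>)\<^sup>2)"
    using indep_var_compose[OF indep_var_noise, of s I Y "\<lambda>x. x\<^sup>2" borel "\<lambda>x. x\<^sup>2" borel] assms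
    by (simp add: L2_def comp_def)
  show "integrable M (\<lambda>\<omega>. (\<zeta> s \<omega> * Y \<omega>)\<^sup>2)"
    "expectation (\<lambda>\<omega>. (\<zeta> s \<omega> * Y \<omega>)\<^sup>2) = expectation (\<lambda>\<omega>. (Y \<omega>)\<^sup>2)"
    using indep_var_integrable[OF * noise_moments(3)] indep_var_lebesgue_integral[OF * noise_moments(3)]
      assms(2) by (simp_all add: L2_def power_mult_distrib noise_moments(4))
qed

lemma L2_noise_mult:
  assumes "L2 I Y" "s \<notin> I"
  shows "L2 (insert s I) (\<lambda>\<omega>. \<zeta> s \<omega> * Y \<omega>)"
proof -
  have "Y \<in> borel_measurable (F (insert s I))"
    using assms(1) by (auto simp: L2_def intro: borel_measurable_noise_algebra_mono[where I = I])
  moreover have "\<zeta> s \<in> borel_measurable (F (insert s I))"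
    by (rule borel_measurable_noise_algebra) simp
  ultimately show ?thesis
    unfolding L2_def using expectation_noise_mult_square(1)[OF assms(2,1)] by (simp add: borel_measurable_times)
qed

text \<open>The \<open>n\<close> latest times up to \<open>t\<close>, empty for
  \<open>n = 0\<close>. The time \<open>t - int n\<close> is left out: a coefficient at lag
  \<open>n\<close> that depends on \<open>past t n\<close> is independent of the noise it
  multiplies.\<close>

abbreviation past :: "int \<Rightarrow> nat \<Rightarrow> int set" where
  "past t n \<equiv> {t - int n + 1..t}"

lemma past_Suc: "past t (Suc n) = insert (t - int n) (past t n)"
  by auto

lemma L2_noise_sum:
  assumes "\<And>i. i < n \<Longrightarrow> L2 (past t i) (f i)"
  shows "L2 (past t n) (\<lambda>\<omega>. c + (\<Sum>i\<in>{m..<n}. \<zeta> (t - int i) \<omega> * f i \<omega>))"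
  using assms
proof (induction n)
  case 0
  then show ?case
    by (simp add: L2_const)
next
  case (Suc n)
  have "L2 (past t (Suc n)) (\<lambda>\<omega>. \<zeta> (t - int n) \<omega> * f n \<omega>)"
    using L2_noise_mult[of "past t n" "f n" "t - int n"] Suc.prems[of n] unfolding past_Suc by auto
  moreover have "L2 (past t (Suc n)) (\<lambda>\<omega>. c + (\<Sum>i\<in>{m..<n}. \<zeta> (t - int i) \<omega> * f i \<omega>))"
    by (rule L2_mono[of "past t n"]) (use Suc in auto)
  ultimately show ?case
    by (cases "m \<le> n") (auto dest: L2_add simp: add.assoc L2_const)
qed

text \<open>Pythagoras: each new term contains a noise variable outside the block on which its
  coefficient and all terms of smaller lag depend. The constant \<open>c\<close> and the lower limit
  \<open>m\<close> allow for arguments of \<open>Q\<close> and for differences of partial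
  sums.\<close>

lemma expectation_noise_sum_square:
  assumes "\<And>i. i < n \<Longrightarrow> L2 (past t i) (f i)"
  shows "expectation (\<lambda>\<omega>. (c + (\<Sum>i\<in>{m..<n}. \<zeta> (t - int i) \<omega> * f i \<omega>))\<^sup>2) =
    c\<^sup>2 + (\<Sum>i\<in>{m..<n}. expectation (\<lambda>\<omega>. (f i \<omega>)\<^sup>2))"
  using assms
proof (induction n)
  case 0
  then show ?case
    by (simp add: prob_space)
next
  case (Suc n)
  show ?case
  proof (cases "m \<le> n")
    case True
    define A where "A \<omega> = c + (\<Sum>i\<in>{m..<n}. \<zeta> (t - int i) \<omega> * f i \<omega>)" for \<omega>
    let ?Z = "\<lambda>\<omega>. \<zeta> (t - int n) \<omega> * f n \<omega>"
    have A: "L2 (past t n) A"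
      unfolding A_def using Suc.prems by (intro L2_noise_sum) auto
    have f: "L2 (past t n) (f n)"
      using Suc.prems by simp
    have notin: "t - int n \<notin> past t n"
      by simp
    \<comment> \<open>Regrouped, the cross term is \<open>\<zeta> (t - int n)\<close> times the
      product of \<open>A\<close> and \<open>f n\<close>, a variable on \<open>past t n\<close>, and
      so has mean zero.\<close>
    have "integrable M (\<lambda>\<omega>. A \<omega> * f n \<omega>)"
      using A f by (intro integrable_mult_squares) (auto simp: L2_def L2_measurable)
    then have cross: "integrable M (\<lambda>\<omega>. \<zeta> (t - int n) \<omega> * (A \<omega> * f n \<omega>))"
      "expectation (\<lambda>\<omega>. \<zeta> (t - int n) \<omega> * (A \<omega> * f n \<omega>)) = 0"
      using expectation_noise_mult[OF notin] A f by (auto simp: L2_def)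
    have "expectation (\<lambda>\<omega>. (A \<omega> + ?Z \<omega>)\<^sup>2) =
        expectation (\<lambda>\<omega>. (A \<omega>)\<^sup>2 + (?Z \<omega>)\<^sup>2 + 2 * (\<zeta> (t - int n) \<omega> * (A \<omega> * f n \<omega>)))"
      by (rule Bochner_Integration.integral_cong) (auto simp: power2_sum)
    also have "\<dots> = expectation (\<lambda>\<omega>. (A \<omega>)\<^sup>2) + expectation (\<lambda>\<omega>. (f n \<omega>)\<^sup>2)"
      using A f cross expectation_noise_mult_square[OF notin f] by (simp add: L2_def)
    also have "expectation (\<lambda>\<omega>. (A \<omega>)\<^sup>2) = c\<^sup>2 + (\<Sum>i\<in>{m..<n}. expectation (\<lambda>\<omega>. (f i \<omega>)\<^sup>2))"
      unfolding A_def using Suc by auto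
    finally show ?thesis
      using True by (simp add: A_def add.assoc)
  next
    case False
    then show ?thesis
      by (simp add: prob_space)
  qed
qed

end

subsection \<open>Mean square sums\<close>

text \<open>The sum over \<open>{t - int n..t}\<close> has \<open>n + 1\<close> terms. Counting
  terms instead shifts the sequence by one and does not affect the limit.\<close>

lemma ms_sum_iff:
  "ms_sum M t f Y \<longleftrightarrow>
     (\<lambda>n. \<integral>\<^sup>+\<omega>. ennreal ((Y \<omega> - (\<Sum>i<n. f (t - int i) \<omega>))\<^sup>2) \<partial>M) \<longlonglongrightarrow> 0"
proof -
  have "{t - int n..t} = {t - int (Suc n)<..t}" for n
    by auto
  then show ?thesis
    unfolding ms_sum_def
    by (simp only: sum_past_reindex
        filterlim_sequentially_Suc[of "\<lambda>n. \<integral>\<^sup>+\<omega>. ennreal ((Y \<omega> - (\<Sum>i<n. f (t - int i) \<omega>))\<^sup>2) \<partial>M"])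
qed

text \<open>The remainders of the series are mean square sums themselves; this gives meaning to the
  dots in the explicit expansion.\<close>

lemma ms_sum_shift:
  assumes "ms_sum M t f Y"
  shows "ms_sum M (t - int k) f (\<lambda>\<omega>. Y \<omega> - (\<Sum>i<k. f (t - int i) \<omega>))"
proof -
  have *: "(\<Sum>i<n + k. f (t - int i) \<omega>) =
      (\<Sum>i<k. f (t - int i) \<omega>) + (\<Sum>i<n. f (t - int k - int i) \<omega>)" for n \<omega>
    by (induction n) (simp_all add: algebra_simps)
  show ?thesis
    using LIMSEQ_ignore_initial_segment[OF assms[unfolded ms_sum_iff], of k]
    unfolding ms_sum_iff * by (simp add: diff_diff_eq)
qed

text \<open>There are countably many terms, so one null set serves all partial sums.\<close>

lemma ms_sum_AE_cong:
  assumes "\<And>s. s \<le> t \<Longrightarrow> AE \<omega> in M. f s \<omega> = g s \<omega>"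
  shows "ms_sum M t f Y \<longleftrightarrow> ms_sum M t g Y"
proof -
  have "AE \<omega> in M. \<forall>i. f (t - int i) \<omega> = g (t - int i) \<omega>"
    unfolding AE_all_countable using assms by simp
  then have "(\<integral>\<^sup>+\<omega>. ennreal ((Y \<omega> - (\<Sum>i<n. f (t - int i) \<omega>))\<^sup>2) \<partial>M) =
      (\<integral>\<^sup>+\<omega>. ennreal ((Y \<omega> - (\<Sum>i<n. g (t - int i) \<omega>))\<^sup>2) \<partial>M)" for n
    by (intro nn_integral_cong_AE) (auto elim!: eventually_mono)
  then show ?thesis
    by (simp add: ms_sum_iff)
qed

lemma sum_second_moments_AE_cong:
  assumes "\<And>s. s \<le> t \<Longrightarrow> AE \<omega> in M. f s \<omega> = g s \<omega>"
  shows "sum_second_moments M t f = sum_second_moments M t g"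
proof -
  have "(\<integral>\<^sup>+\<omega>. ennreal ((f (t - int n) \<omega>)\<^sup>2) \<partial>M) = (\<integral>\<^sup>+\<omega>. ennreal ((g (t - int n) \<omega>)\<^sup>2) \<partial>M)" for n
    using assms[of "t - int n"] by (intro nn_integral_cong_AE) (auto elim!: eventually_mono)
  then show ?thesis
    by (simp add: sum_second_moments_def)
qed

lemma ms_sum_unique:
  assumes [measurable]: "Y \<in> borel_measurable M" "Z \<in> borel_measurable M"
    and f: "\<And>s. s \<le> t \<Longrightarrow> f s \<in> borel_measurable M"
    and "ms_sum M t f Y" "ms_sum M t f Z"
  shows "AE \<omega> in M. Y \<omega> = Z \<omega>"
proof -
  let ?D = "\<lambda>X n. \<integral>\<^sup>+\<omega>. ennreal ((X \<omega> - (\<Sum>i<n. f (t - int i) \<omega>))\<^sup>2) \<partial>M"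
  have [measurable]: "f (t - int i) \<in> borel_measurable M" for i
    using f by simp
  have "(\<integral>\<^sup>+\<omega>. ennreal ((Y \<omega> - Z \<omega>)\<^sup>2) \<partial>M) \<le> 2 * ?D Y n + 2 * ?D Z n" for n
  proof -
    have "ennreal ((y - z)\<^sup>2) \<le> 2 * ennreal ((y - s)\<^sup>2) + 2 * ennreal ((z - s)\<^sup>2)" for y z s :: real
    proof -
      \<comment> \<open>Parallelogram identity: the slack in the inequality is a square.\<close>
      have "2 * (y - s)\<^sup>2 + 2 * (z - s)\<^sup>2 - (y - z)\<^sup>2 = ((y - s) + (z - s))\<^sup>2"
        by (simp add: power2_eq_square algebra_simps)
      then have "(y - z)\<^sup>2 \<le> 2 * (y - s)\<^sup>2 + 2 * (z - s)\<^sup>2"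
        using zero_le_power2[of "(y - s) + (z - s)"] by linarith
      then have "ennreal ((y - z)\<^sup>2) \<le> ennreal (2 * (y - s)\<^sup>2 + 2 * (z - s)\<^sup>2)"
        by (rule ennreal_leI)
      then show ?thesis
        by (simp add: ennreal_plus ennreal_mult)
    qed
    then have "(\<integral>\<^sup>+\<omega>. ennreal ((Y \<omega> - Z \<omega>)\<^sup>2) \<partial>M) \<le>
        (\<integral>\<^sup>+\<omega>. 2 * ennreal ((Y \<omega> - (\<Sum>i<n. f (t - int i) \<omega>))\<^sup>2) +
                2 * ennreal ((Z \<omega> - (\<Sum>i<n. f (t - int i) \<omega>))\<^sup>2) \<partial>M)"
      by (intro nn_integral_mono)
    then show ?thesis
      by (simp add: nn_integral_add nn_integral_cmult)
  qed
  moreover have "(\<lambda>n. 2 * ?D Y n + 2 * ?D Z n) \<longlonglongrightarrow> 2 * 0 + 2 * 0"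
    using assms(4,5) unfolding ms_sum_iff by (intro tendsto_add ennreal_tendsto_cmult) auto
  ultimately have "(\<integral>\<^sup>+\<omega>. ennreal ((Y \<omega> - Z \<omega>)\<^sup>2) \<partial>M) \<le> 2 * 0 + 2 * 0"
    by (intro LIMSEQ_le_const) auto
  then have "(\<integral>\<^sup>+\<omega>. ennreal ((Y \<omega> - Z \<omega>)\<^sup>2) \<partial>M) = 0"
    by simp
  then show ?thesis
    by (subst (asm) nn_integral_0_iff_AE) (auto elim!: eventually_mono simp: ennreal_eq_0_iff)
qed

lemma integrable_square_iff:
  fixes Y :: "'a \<Rightarrow> real"
  assumes [measurable]: "Y \<in> borel_measurable M"
  shows "integrable M (\<lambda>\<omega>. (Y \<omega>)\<^sup>2) \<longleftrightarrow> (\<integral>\<^sup>+\<omega>. ennreal ((Y \<omega>)\<^sup>2) \<partial>M) < \<infinity>"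
  by (simp add: integrable_iff_bounded)

lemma nn_integral_square:
  fixes Y :: "'a \<Rightarrow> real"
  assumes "integrable M (\<lambda>\<omega>. (Y \<omega>)\<^sup>2)"
  shows "(\<integral>\<^sup>+\<omega>. ennreal ((Y \<omega>)\<^sup>2) \<partial>M) = ennreal (integral\<^sup>L M (\<lambda>\<omega>. (Y \<omega>)\<^sup>2))"
  using assms by (intro nn_integral_eq_integral) auto

context iid_noise
begin

section \<open>Conditional expectations of mean square sums\<close>

lemma L2_integrable: "L2 I Y \<Longrightarrow> integrable M Y"
  by (rule square_integrable_imp_integrable) (auto simp: L2_def F_measurable_M)

lemma L2_partial_sum:
  assumes "\<And>i. L2 (past t i) (f (t - int i))"
  shows "L2 (past t n) (\<lambda>\<omega>. c + (\<Sum>i<n. \<zeta> (t - int i) \<omega> * f (t - int i) \<omega>))"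
  using L2_noise_sum[where m = 0 and n = n and f = "\<lambda>i. f (t - int i)" and c = c] assms by (simp add: atLeast0LessThan)

text \<open>Martingale property in the lag: over an event of the first \<open>n\<close> noise
  variables, every term of lag at least \<open>n\<close> integrates to zero.\<close>

lemma set_integral_noise_sum_eq:
  assumes f: "\<And>i. L2 (past t i) (f (t - int i))"
    and A: "A \<in> sets (F (past t n))" and "n \<le> m"
  shows "expectation (\<lambda>\<omega>. indicator A \<omega> * (c + (\<Sum>i<m. \<zeta> (t - int i) \<omega> * f (t - int i) \<omega>))) =
    expectation (\<lambda>\<omega>. indicator A \<omega> * (c + (\<Sum>i<n. \<zeta> (t - int i) \<omega> * f (t - int i) \<omega>)))"
  using \<open>n \<le> m\<close>
proof (induction m rule: dec_induct)
  case base
  then show ?case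
    by simp
next
  case (step m)
  have AM: "A \<in> sets M"
    using A subalgebra_F by (auto simp: subalgebra_def)
  have Am: "A \<in> sets (F (past t m))"
    using A step.hyps subalgebra_noise_algebra_mono[of "past t n" "past t m" M \<zeta>]
    by (auto simp: subalgebra_def)
  have int: "integrable M (\<lambda>\<omega>. indicator A \<omega> * Y \<omega>)" if "L2 I Y" for I and Y :: "'a \<Rightarrow> real"
    using integrable_mult_indicator[OF AM L2_integrable[OF that]] by simp
  have fm: "f (t - int m) \<in> borel_measurable (F (past t m))"
    using f by (simp add: L2_def)
  have meas: "(\<lambda>\<omega>. indicator A \<omega> * f (t - int m) \<omega>) \<in> borel_measurable (F (past t m))"
    by (rule borel_measurable_times[OF borel_measurable_indicator[OF Am] fm])
  have notin: "t - int m \<notin> past t m"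
    by simp
  \<comment> \<open>The indicator is absorbed into the coefficient, which stays a function of
    \<open>past t m\<close> and hence independent of \<open>\<zeta> (t - int m)\<close>.\<close>
  note Z = expectation_noise_mult[OF notin meas int[OF f[of m]]]
  let ?S = "\<lambda>\<omega>. c + (\<Sum>i<m. \<zeta> (t - int i) \<omega> * f (t - int i) \<omega>)"
  have "expectation (\<lambda>\<omega>. indicator A \<omega> * (c + (\<Sum>i<Suc m. \<zeta> (t - int i) \<omega> * f (t - int i) \<omega>))) =
      expectation (\<lambda>\<omega>. indicator A \<omega> * ?S \<omega> + \<zeta> (t - int m) \<omega> * (indicator A \<omega> * f (t - int m) \<omega>))"
    by (intro Bochner_Integration.integral_cong) (simp_all add: algebra_simps)
  also have "\<dots> = expectation (\<lambda>\<omega>. indicator A \<omega> * ?S \<omega>)"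
    using Z int[OF L2_partial_sum[OF f, where n = m and c = c]] by simp
  finally show ?case
    using step.IH by simp
qed

text \<open>The set integral of the partial sums is constant from \<open>n\<close> on, and mean
  square convergence carries it over to the limit.\<close>

lemma set_integral_ms_sum:
  assumes f: "\<And>i. L2 (past t i) (f (t - int i))"
    and X [measurable]: "X \<in> borel_measurable M" and X2: "integrable M (\<lambda>\<omega>. (X \<omega>)\<^sup>2)"
    and lim: "ms_sum M t (\<lambda>s \<omega>. \<zeta> s \<omega> * f s \<omega>) (\<lambda>\<omega>. X \<omega> - c)"
    and A: "A \<in> sets (F (past t n))"
  shows "expectation (\<lambda>\<omega>. indicator A \<omega> * X \<omega>) =
    expectation (\<lambda>\<omega>. indicator A \<omega> * (c + (\<Sum>i<n. \<zeta> (t - int i) \<omega> * f (t - int i) \<omega>)))"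
proof -
  define S where "S m \<omega> = c + (\<Sum>i<m. \<zeta> (t - int i) \<omega> * f (t - int i) \<omega>)" for m \<omega>
  have AM [measurable]: "A \<in> sets M"
    using A subalgebra_F by (auto simp: subalgebra_def)
  have S: "L2 (past t m) (S m)" for m
    unfolding S_def by (rule L2_partial_sum) (rule f)
  have [measurable]: "S m \<in> borel_measurable M" for m
    using S L2_measurable by blast
  have diff2: "integrable M (\<lambda>\<omega>. (X \<omega> - S m \<omega>)\<^sup>2)" for m
    using integrable_square_add[OF X _ X2, of "\<lambda>\<omega>. - S m \<omega>"] S by (simp add: L2_def)
  have int: "integrable M (\<lambda>\<omega>. indicator A \<omega> * Y \<omega>)"
    if [measurable]: "Y \<in> borel_measurable M" and "integrable M (\<lambda>\<omega>. (Y \<omega>)\<^sup>2)" for Y :: "'a \<Rightarrow> real"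
    using integrable_mult_indicator[OF AM square_integrable_imp_integrable[OF that]] by simp
  have intS: "integrable M (\<lambda>\<omega>. indicator A \<omega> * S m \<omega>)" for m
    using S by (intro int) (auto simp: L2_def)
  \<comment> \<open>\<open>d\<close> is the defect in the claim. For every \<open>m \<ge> n\<close>
    it can be computed with \<open>S m\<close> in place of \<open>S n\<close>, so its square is
    bounded by a quantity that tends to zero.\<close>
  define d where "d = expectation (\<lambda>\<omega>. indicator A \<omega> * X \<omega>) - expectation (\<lambda>\<omega>. indicator A \<omega> * S n \<omega>)"
  have bound: "d\<^sup>2 \<le> expectation (\<lambda>\<omega>. (X \<omega> - S m \<omega>)\<^sup>2)" if "m \<ge> n" for m
  proof -
    have "d = expectation (\<lambda>\<omega>. indicator A \<omega> * X \<omega>) - expectation (\<lambda>\<omega>. indicator A \<omega> * S m \<omega>)"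
      unfolding d_def S_def using set_integral_noise_sum_eq[OF f A that] by simp
    also have "\<dots> = expectation (\<lambda>\<omega>. indicator A \<omega> * (X \<omega> - S m \<omega>))"
      using int[OF X X2] intS by (simp add: right_diff_distrib)
    finally have d: "d = \<dots>" .
    have sq: "integrable M (\<lambda>\<omega>. (indicator A \<omega> * (X \<omega> - S m \<omega>))\<^sup>2)"
      by (rule Bochner_Integration.integrable_bound[OF diff2[of m]]) (auto simp: indicator_def)
    have "d\<^sup>2 \<le> expectation (\<lambda>\<omega>. (indicator A \<omega> * (X \<omega> - S m \<omega>))\<^sup>2)"
      unfolding d using sq by (intro square_expectation_le) auto
    also have "\<dots> \<le> expectation (\<lambda>\<omega>. (X \<omega> - S m \<omega>)\<^sup>2)"
      using sq diff2 by (intro integral_mono) (auto simp: indicator_def)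
    finally show ?thesis .
  qed
  have "(\<lambda>m. ennreal (expectation (\<lambda>\<omega>. (X \<omega> - S m \<omega>)\<^sup>2))) \<longlonglongrightarrow> 0"
    using lim unfolding ms_sum_iff by (simp add: S_def nn_integral_square[OF diff2[unfolded S_def]] diff_diff_eq)
  then have "(\<lambda>m. expectation (\<lambda>\<omega>. (X \<omega> - S m \<omega>)\<^sup>2)) \<longlonglongrightarrow> 0"
    by (subst (asm) ennreal_tendsto_0_iff) auto
  then have "d\<^sup>2 \<le> 0"
    using bound by (intro LIMSEQ_le_const) auto
  then show ?thesis
    by (simp add: d_def S_def)
qed

text \<open>The truncated sum depends only on \<open>past t n\<close> and has the same integrals as
  \<open>X\<close> over events of that block, which characterizes the conditional
  expectation.\<close>

lemma cond_exp_ms_sum: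
  assumes f: "\<And>i. L2 (past t i) (f (t - int i))"
    and X [measurable]: "X \<in> borel_measurable M" and X2: "integrable M (\<lambda>\<omega>. (X \<omega>)\<^sup>2)"
    and lim: "ms_sum M t (\<lambda>s \<omega>. \<zeta> s \<omega> * f s \<omega>) (\<lambda>\<omega>. X \<omega> - c)"
  shows "AE \<omega> in M. real_cond_exp M (F (past t n)) X \<omega> =
    c + (\<Sum>i<n. \<zeta> (t - int i) \<omega> * f (t - int i) \<omega>)"
proof (rule sigma_finite_subalgebra.real_cond_exp_charact[OF sigma_finite_subalgebra_F])
  let ?S = "\<lambda>\<omega>. c + (\<Sum>i<n. \<zeta> (t - int i) \<omega> * f (t - int i) \<omega>)"
  have S: "L2 (past t n) ?S"
    by (rule L2_partial_sum) (rule f)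
  then show "?S \<in> borel_measurable (F (past t n))"
    by (simp add: L2_def)
  show "integrable M X"
    by (rule square_integrable_imp_integrable[OF X X2])
  show "integrable M ?S"
    using S by (rule L2_integrable)
  show "(LINT \<omega>:A|M. X \<omega>) = (LINT \<omega>:A|M. ?S \<omega>)" if "A \<in> sets (F (past t n))" for A
    using set_integral_ms_sum[OF assms that] by (simp add: set_lebesgue_integral_def)
qed

lemma expectation_ms_sum:
  assumes "\<And>i. L2 (past t i) (f (t - int i))"
    and "X \<in> borel_measurable M" "integrable M (\<lambda>\<omega>. (X \<omega>)\<^sup>2)"
    and "ms_sum M t (\<lambda>s \<omega>. \<zeta> s \<omega> * f s \<omega>) (\<lambda>\<omega>. X \<omega> - c)"
  shows "expectation X = c"
proof -
  \<comment> \<open>For \<open>n = 0\<close> the block is empty, the truncated sum is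
    \<open>c\<close>, and the whole space is an admissible event.\<close>
  have "space M \<in> sets (F (past t 0))"
    using sets.top[of "F (past t 0)"] by simp
  from set_integral_ms_sum[OF assms this]
  have "expectation (\<lambda>\<omega>. indicator (space M) \<omega> * X \<omega>) = expectation (\<lambda>\<omega>. indicator (space M) \<omega> * c)"
    by simp
  also have "expectation (\<lambda>\<omega>. indicator (space M) \<omega> * X \<omega>) = expectation X"
    by (rule Bochner_Integration.integral_cong) auto
  also have "expectation (\<lambda>\<omega>. indicator (space M) \<omega> * c) = expectation (\<lambda>\<omega>. c)"
    by (rule Bochner_Integration.integral_cong) auto
  finally show ?thesis
    by (simp add: prob_space)
qed

text \<open>Conditioning on \<open>[u, t]\<close> and on \<open>[u + 1, t]\<close> truncates the sum
  at consecutive places, so the increment is the single term at \<open>u\<close>. The null set is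
  chosen before \<open>n\<close>, since the kernels are later compared path by path.\<close>

lemma proj_kernel_ms_sum:
  assumes "\<And>i. L2 (past t i) (f (t - int i))"
    and "X t \<in> borel_measurable M" "integrable M (\<lambda>\<omega>. (X t \<omega>)\<^sup>2)"
    and "ms_sum M t (\<lambda>s \<omega>. \<zeta> s \<omega> * f s \<omega>) (\<lambda>\<omega>. X t \<omega> - c)"
  shows "AE \<omega> in M. \<forall>n. proj_kernel M \<zeta> Q \<alpha> \<beta> X (t - int n) t \<omega> =
    Q (\<alpha> n + (\<Sum>i<n. \<zeta> (t - int i) \<omega> * (\<beta> i (n - i) * f (t - int i) \<omega>)))"
proof -
  have "AE \<omega> in M. \<forall>n. real_cond_exp M (F (past t n)) (X t) \<omega> =
      c + (\<Sum>i<n. \<zeta> (t - int i) \<omega> * f (t - int i) \<omega>)"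
    unfolding AE_all_countable by (intro allI cond_exp_ms_sum assms)
  then show ?thesis
  proof (eventually_elim, intro allI)
    fix \<omega> n
    assume *: "\<forall>n. real_cond_exp M (F (past t n)) (X t) \<omega> =
      c + (\<Sum>i<n. \<zeta> (t - int i) \<omega> * f (t - int i) \<omega>)"
    \<comment> \<open>\<open>{t - int i..t}\<close> is \<open>past t (Suc i)\<close> and
      \<open>{t - int i + 1..t}\<close> is \<open>past t i\<close>.\<close>
    have "real_cond_exp M (F {t - int i..t}) (X t) \<omega> - real_cond_exp M (F {t - int i + 1..t}) (X t) \<omega> =
        \<zeta> (t - int i) \<omega> * f (t - int i) \<omega>" for i
      using *[rule_format, of i] *[rule_format, of "Suc i"] by simp
    moreover have "nat (t - int i - (t - int n)) = n - i" for i
      by linarith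
    ultimately show "proj_kernel M \<zeta> Q \<alpha> \<beta> X (t - int n) t \<omega> =
        Q (\<alpha> n + (\<Sum>i<n. \<zeta> (t - int i) \<omega> * (\<beta> i (n - i) * f (t - int i) \<omega>)))"
      unfolding proj_kernel_def sum_past_reindex by (simp add: mult_ac)
  qed
qed

section \<open>Convergence of orthogonal series\<close>

text \<open>Riesz-Fischer argument: orthogonality makes the partial sums Cauchy in mean square, a
  subsequence converges almost everywhere, and Fatou's lemma turns this into mean square convergence
  of the whole sequence.\<close>

lemma ms_sum_exists:
  assumes f: "\<And>i. L2 (past t i) (f (t - int i))"
    and summable: "summable (\<lambda>i. expectation (\<lambda>\<omega>. (f (t - int i) \<omega>)\<^sup>2))"
  obtains X where "X \<in> borel_measurable (F {..t})" "integrable M (\<lambda>\<omega>. (X \<omega>)\<^sup>2)"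
    "ms_sum M t (\<lambda>s \<omega>. \<zeta> s \<omega> * f s \<omega>) (\<lambda>\<omega>. X \<omega> - c)"
proof -
  define v where "v i = expectation (\<lambda>\<omega>. (f (t - int i) \<omega>)\<^sup>2)" for i
  define S where "S m \<omega> = c + (\<Sum>i<m. \<zeta> (t - int i) \<omega> * f (t - int i) \<omega>)" for m \<omega>
  \<comment> \<open>\<open>T n\<close> is the tail of the series of second moments; it bounds the
    mean square distance of every later partial sum from \<open>S n\<close>.\<close>
  define T where "T n = suminf v - sum v {..<n}" for n
  have v: "v i \<ge> 0" for i
    by (simp add: v_def)
  have sv: "summable v"
    using summable by (simp add: v_def[abs_def])
  have S: "L2 (past t m) (S m)" for m
    unfolding S_def by (rule L2_partial_sum) (rule f)
  have [measurable]: "S m \<in> borel_measurable M" for m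
    using S L2_measurable by blast
  have S2: "integrable M (\<lambda>\<omega>. (S m \<omega>)\<^sup>2)" for m
    using S by (simp add: L2_def)
  have diff2: "integrable M (\<lambda>\<omega>. (S m \<omega> - S n \<omega>)\<^sup>2)" for m n
    using integrable_square_add[of "S m" "\<lambda>\<omega>. - S n \<omega>"] S2 by simp
  have ES: "expectation (\<lambda>\<omega>. (S m \<omega> - S n \<omega>)\<^sup>2) = sum v {n..<m}" if "n \<le> m" for m n
  proof -
    have "S m \<omega> - S n \<omega> = 0 + (\<Sum>i\<in>{n..<m}. \<zeta> (t - int i) \<omega> * f (t - int i) \<omega>)" for \<omega>
      using sum_diff_nat_ivl[of 0 n m "\<lambda>i. \<zeta> (t - int i) \<omega> * f (t - int i) \<omega>"] that
      by (simp add: S_def atLeast0LessThan)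
    then show ?thesis
      using expectation_noise_sum_square[where n = m and m = n and f = "\<lambda>i. f (t - int i)" and c = 0] f by (simp add: v_def)
  qed
  \<comment> \<open>\<open>cauchy_L1_AE_cauchy_subseq\<close> asks for the Cauchy property in L1; it
    follows from the one in L2 by \<open>square_expectation_le\<close>.\<close>
  have L1: "\<exists>N. \<forall>i\<ge>N. \<forall>j\<ge>N. (LINT \<omega>|M. norm (S i \<omega> - S j \<omega>)) < e" if "e > 0" for e
  proof -
    obtain N where N: "\<And>m n. m \<ge> N \<Longrightarrow> norm (sum v {m..<n}) < e\<^sup>2"
      using sv[unfolded summable_Cauchy, rule_format, of "e\<^sup>2"] \<open>e > 0\<close> by auto
    have less: "(LINT \<omega>|M. norm (S i \<omega> - S j \<omega>)) < e" if "N \<le> j" "j \<le> i" for i j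
    proof -
      have "(LINT \<omega>|M. norm (S i \<omega> - S j \<omega>))\<^sup>2 \<le> (LINT \<omega>|M. (norm (S i \<omega> - S j \<omega>))\<^sup>2)"
        using diff2 by (intro square_expectation_le) auto
      also have "\<dots> = sum v {j..<i}"
        using ES[OF \<open>j \<le> i\<close>] by simp
      also have "\<dots> < e\<^sup>2"
        using N[OF \<open>N \<le> j\<close>, of i] by simp
      finally show ?thesis
        by (rule power2_less_imp_less) (use \<open>e > 0\<close> in simp)
    qed
    have "(LINT \<omega>|M. norm (S i \<omega> - S j \<omega>)) < e" if "N \<le> j" "N \<le> i" for i j
      using less[of j i] less[of i j] that by (cases "j \<le> i") (auto simp: abs_minus_commute)
    then show ?thesis
      by blast
  qed
  obtain r where r: "strict_mono r" and Cauchy: "AE \<omega> in M. Cauchy (\<lambda>k. S (r k) \<omega>)"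
    by (rule cauchy_L1_AE_cauchy_subseq[OF L2_integrable[OF S] L1])
  \<comment> \<open>A pointwise limit, with some default value where the subsequence diverges, is
    measurable for the noise algebra on \<open>{..t}\<close> itself and not merely up to null
    sets.\<close>
  define X where "X \<omega> = lim (\<lambda>k. S (r k) \<omega>)" for \<omega>
  have "S m \<in> borel_measurable (F {..t})" for m
    using S[of m] by (auto simp: L2_def intro: borel_measurable_noise_algebra_mono[where I = "past t m"])
  then have XF: "X \<in> borel_measurable (F {..t})"
    unfolding X_def by measurable
  then have [measurable]: "X \<in> borel_measurable M"
    by (rule F_measurable_M)
  have conv: "AE \<omega> in M. (\<lambda>k. S (r k) \<omega>) \<longlonglongrightarrow> X \<omega>"
    using Cauchy unfolding X_def by eventually_elim (simp add: Cauchy_convergent_iff convergent_LIMSEQ_iff)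
  have le_T: "sum v {n..<m} \<le> T n" if "n \<le> m" for m n
    using sum_le_suminf[OF sv, of "{..<m}"] v sum_diff_nat_ivl[of 0 n m v] that
    by (simp add: T_def atLeast0LessThan)
  have bound: "(\<integral>\<^sup>+\<omega>. ennreal ((X \<omega> - S n \<omega>)\<^sup>2) \<partial>M) \<le> ennreal (T n)" for n
  proof -
    have "(\<integral>\<^sup>+\<omega>. ennreal ((X \<omega> - S n \<omega>)\<^sup>2) \<partial>M) =
        (\<integral>\<^sup>+\<omega>. liminf (\<lambda>k. ennreal ((S (r k) \<omega> - S n \<omega>)\<^sup>2)) \<partial>M)"
      using conv
    proof (intro nn_integral_cong_AE, eventually_elim)
      fix \<omega>
      assume "(\<lambda>k. S (r k) \<omega>) \<longlonglongrightarrow> X \<omega>"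
      then have "(\<lambda>k. ennreal ((S (r k) \<omega> - S n \<omega>)\<^sup>2)) \<longlonglongrightarrow> ennreal ((X \<omega> - S n \<omega>)\<^sup>2)"
        by (intro tendsto_intros)
      then show "ennreal ((X \<omega> - S n \<omega>)\<^sup>2) = liminf (\<lambda>k. ennreal ((S (r k) \<omega> - S n \<omega>)\<^sup>2))"
        by (intro lim_imp_Liminf[symmetric]) auto
    qed
    also have "\<dots> \<le> liminf (\<lambda>k. \<integral>\<^sup>+\<omega>. ennreal ((S (r k) \<omega> - S n \<omega>)\<^sup>2) \<partial>M)"
      by (rule nn_integral_liminf) measurable
    also have "\<dots> \<le> ennreal (T n)"
    proof (rule Liminf_le)
      show "\<forall>\<^sub>F k in sequentially. (\<integral>\<^sup>+\<omega>. ennreal ((S (r k) \<omega> - S n \<omega>)\<^sup>2) \<partial>M) \<le> ennreal (T n)"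
        using eventually_ge_at_top[of n]
      proof eventually_elim
        case (elim k)
        then have "n \<le> r k"
          using strict_mono_imp_increasing[OF r, of k] by linarith
        then show ?case
          using le_T[of n "r k"] by (simp add: nn_integral_square[OF diff2] ES ennreal_leI)
      qed
    qed simp
    finally show ?thesis .
  qed
  have "T \<longlonglongrightarrow> suminf v - suminf v"
    unfolding T_def by (intro tendsto_intros summable_LIMSEQ sv)
  then have T: "(\<lambda>n. ennreal (T n)) \<longlonglongrightarrow> ennreal 0"
    by (intro tendsto_ennrealI) simp
  have "(\<lambda>n. \<integral>\<^sup>+\<omega>. ennreal ((X \<omega> - S n \<omega>)\<^sup>2) \<partial>M) \<longlonglongrightarrow> 0"
  proof (rule tendsto_sandwich[OF _ _ tendsto_const])
    show "(\<lambda>n. ennreal (T n)) \<longlonglongrightarrow> 0"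
      using T by simp
  qed (simp_all add: bound)
  then have "ms_sum M t (\<lambda>s \<omega>. \<zeta> s \<omega> * f s \<omega>) (\<lambda>\<omega>. X \<omega> - c)"
    by (simp add: ms_sum_iff S_def diff_diff_eq)
  moreover have "integrable M (\<lambda>\<omega>. (X \<omega>)\<^sup>2)"
  proof -
    \<comment> \<open>\<open>S 0\<close> is the constant \<open>c\<close>, so square integrability
      passes from the difference to \<open>X\<close>.\<close>
    have "integrable M (\<lambda>\<omega>. (X \<omega> - S 0 \<omega>)\<^sup>2)"
      using le_less_trans[OF bound[of 0] ennreal_less_top] by (subst integrable_square_iff) simp_all
    from integrable_square_add[OF _ _ this S2[of 0]] have "integrable M (\<lambda>\<omega>. (X \<omega> - S 0 \<omega> + S 0 \<omega>)\<^sup>2)"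
      by measurable
    then show ?thesis
      by simp
  qed
  ultimately show ?thesis
    using XF that by blast
qed

end

subsection \<open>The projective equation\<close>

locale projective_equation = iid_noise M \<zeta> for M :: "'a measure" and \<zeta> +
  fixes Q :: "real \<Rightarrow> real" and \<alpha> :: "nat \<Rightarrow> real" and \<beta> :: "nat \<Rightarrow> nat \<Rightarrow> real" and c \<mu> :: real
  assumes Q_measurable [measurable]: "Q \<in> borel_measurable borel"
    and Q_bound: "\<And>x. \<bar>Q x\<bar> \<le> c * \<bar>x\<bar>"
begin

section \<open>The recursive coefficients and their second moments\<close>

abbreviation g :: "int \<Rightarrow> int \<Rightarrow> 'a \<Rightarrow> real" where
  "g s t \<omega> \<equiv> proj_coeff Q \<alpha> \<beta> (\<lambda>u. \<zeta> u \<omega>) t (nat (t - s))"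

lemma Q_square_bound: "(Q x)\<^sup>2 \<le> c\<^sup>2 * x\<^sup>2"
  using power_mono[OF Q_bound[of x], of 2] by (simp add: power_mult_distrib)

lemma g_rec:
  "g (t - int n) t \<omega> = Q (\<alpha> n + (\<Sum>i<n. \<zeta> (t - int i) \<omega> * (\<beta> i (n - i) * g (t - int i) t \<omega>)))"
  using proj_coeff_rec[of Q \<alpha> \<beta> "\<lambda>u. \<zeta> u \<omega>" t n] by simp

lemma g_measurable: "g (t - int n) t \<in> borel_measurable (F (past t n))"
proof -
  have "(\<lambda>\<omega>. proj_coeff Q \<alpha> \<beta> (\<lambda>u. \<zeta> u \<omega>) t n) \<in> borel_measurable (F (past t n))"
  proof (rule measurable_proj_coeff[OF Q_measurable])
    show "(\<lambda>\<omega>. \<zeta> (t - int i) \<omega>) \<in> borel_measurable (F (past t n))" if "i < n" for i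
      using that by (intro borel_measurable_noise_algebra) auto
  qed
  then show ?thesis
    by simp
qed

lemma L2_kernel_argument:
  assumes "\<And>i. i < n \<Longrightarrow> L2 (past t i) (g (t - int i) t)"
  shows "L2 (past t n)
    (\<lambda>\<omega>. \<alpha> n + (\<Sum>i<n. \<zeta> (t - int i) \<omega> * (\<beta> i (n - i) * g (t - int i) t \<omega>)))"
  using L2_noise_sum[where m = 0 and n = n and t = t
      and f = "\<lambda>i \<omega>. \<beta> i (n - i) * g (t - int i) t \<omega>" and c = "\<alpha> n"] assms
  by (simp add: L2_cmult atLeast0LessThan)

text \<open>Strong induction: coefficients of smaller lag in L2 put the argument of \<open>Q\<close>
  in L2, and \<open>Q\<close> grows at most linearly.\<close>

lemma L2_g: "L2 (past t n) (g (t - int n) t)"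
proof (induction n rule: less_induct)
  case (less n)
  let ?A = "\<lambda>\<omega>. \<alpha> n + (\<Sum>i<n. \<zeta> (t - int i) \<omega> * (\<beta> i (n - i) * g (t - int i) t \<omega>))"
  have A: "L2 (past t n) ?A"
    by (rule L2_kernel_argument) (rule less)
  have [measurable]: "?A \<in> borel_measurable M"
    using A by (rule L2_measurable)
  have "integrable M (\<lambda>\<omega>. (Q (?A \<omega>))\<^sup>2)"
  proof (rule Bochner_Integration.integrable_bound)
    show "integrable M (\<lambda>\<omega>. c\<^sup>2 * (?A \<omega>)\<^sup>2)"
      using A by (simp add: L2_def)
    show "AE \<omega> in M. norm ((Q (?A \<omega>))\<^sup>2) \<le> norm (c\<^sup>2 * (?A \<omega>)\<^sup>2)"
      using Q_square_bound by (simp add: abs_mult)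
  qed measurable
  then have "integrable M (\<lambda>\<omega>. (g (t - int n) t \<omega>)\<^sup>2)"
    by (simp only: g_rec[where t = t and n = n])
  then show ?case
    using g_measurable by (simp only: L2_def)
qed

text \<open>This is the \<open>v k\<close> of the introduction, with \<open>t\<close> kept as a
  parameter; the recursion below has the same constants for every \<open>t\<close>.\<close>

definition coeff_moment :: "int \<Rightarrow> nat \<Rightarrow> real" where
  "coeff_moment t n = expectation (\<lambda>\<omega>. (g (t - int n) t \<omega>)\<^sup>2)"

lemma coeff_moment_nonneg: "coeff_moment t n \<ge> 0"
  by (simp add: coeff_moment_def)

lemma expectation_kernel_argument:
  "expectation (\<lambda>\<omega>. (\<alpha> n + (\<Sum>i<n. \<zeta> (t - int i) \<omega> * (\<beta> i (n - i) * g (t - int i) t \<omega>)))\<^sup>2) =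
     (\<alpha> n)\<^sup>2 + (\<Sum>i<n. (\<beta> i (n - i))\<^sup>2 * coeff_moment t i)"
proof -
  have "L2 (past t i) (\<lambda>\<omega>. \<beta> i (n - i) * g (t - int i) t \<omega>)" for i
    by (rule L2_cmult) (rule L2_g)
  from expectation_noise_sum_square[where m = 0 and n = n and t = t and c = "\<alpha> n"
      and f = "\<lambda>i \<omega>. \<beta> i (n - i) * g (t - int i) t \<omega>", OF this]
  show ?thesis
    by (simp add: coeff_moment_def power_mult_distrib atLeast0LessThan)
qed

text \<open>The growth bound on \<open>Q\<close> gives the inequality, and orthogonality evaluates
  the second moment of the argument.\<close>

lemma coeff_moment_le: "coeff_moment t n \<le> c\<^sup>2 * ((\<alpha> n)\<^sup>2 + (\<Sum>i<n. (\<beta> i (n - i))\<^sup>2 * coeff_moment t i))"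
proof -
  let ?A = "\<lambda>\<omega>. \<alpha> n + (\<Sum>i<n. \<zeta> (t - int i) \<omega> * (\<beta> i (n - i) * g (t - int i) t \<omega>))"
  have "coeff_moment t n \<le> expectation (\<lambda>\<omega>. c\<^sup>2 * (?A \<omega>)\<^sup>2)"
    unfolding coeff_moment_def
  proof (rule integral_mono)
    show "integrable M (\<lambda>\<omega>. (g (t - int n) t \<omega>)\<^sup>2)"
      using L2_g unfolding L2_def by blast
    show "integrable M (\<lambda>\<omega>. c\<^sup>2 * (?A \<omega>)\<^sup>2)"
      using L2_kernel_argument[OF L2_g, where n = n and t = t] by (simp add: L2_def)
    show "(g (t - int n) t \<omega>)\<^sup>2 \<le> c\<^sup>2 * (?A \<omega>)\<^sup>2" for \<omega>
      unfolding g_rec[where t = t and n = n] by (rule Q_square_bound)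
  qed
  then show ?thesis
    using expectation_kernel_argument[where n = n and t = t] by simp
qed

text \<open>For linear \<open>Q\<close> the growth bound on the squares is an identity.\<close>

lemma coeff_moment_eq:
  assumes "\<And>x. Q x = c * x"
  shows "coeff_moment t n = c\<^sup>2 * ((\<alpha> n)\<^sup>2 + (\<Sum>i<n. (\<beta> i (n - i))\<^sup>2 * coeff_moment t i))"
proof -
  let ?A = "\<lambda>\<omega>. \<alpha> n + (\<Sum>i<n. \<zeta> (t - int i) \<omega> * (\<beta> i (n - i) * g (t - int i) t \<omega>))"
  have "coeff_moment t n = expectation (\<lambda>\<omega>. c\<^sup>2 * (?A \<omega>)\<^sup>2)"
    unfolding coeff_moment_def g_rec[where t = t and n = n] by (simp only: assms power_mult_distrib)
  then show ?thesis
    using expectation_kernel_argument[where n = n and t = t] by simp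
qed

lemma sum_second_moments_g: "sum_second_moments M t (\<lambda>s. g s t) = (\<Sum>n. ennreal (coeff_moment t n))"
proof -
  have "integrable M (\<lambda>\<omega>. (g (t - int n) t \<omega>)\<^sup>2)" for n
    using L2_g unfolding L2_def by blast
  from nn_integral_square[OF this] show ?thesis
    by (simp add: sum_second_moments_def coeff_moment_def)
qed

section \<open>Solutions and their kernels\<close>

text \<open>The kernel at lag \<open>n\<close> involves \<open>X t\<close> only through conditional
  expectations given noise in \<open>past t n\<close>. It is thus admissible as the coefficient of a
  mean square sum before anything is known about its form.\<close>

lemma L2_proj_kernel:
  assumes "sum_second_moments M t (\<lambda>s. proj_kernel M \<zeta> Q \<alpha> \<beta> X s t) < \<infinity>"
  shows "L2 (past t n) (proj_kernel M \<zeta> Q \<alpha> \<beta> X (t - int n) t)"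
proof -
  let ?K = "proj_kernel M \<zeta> Q \<alpha> \<beta> X (t - int n) t"
  have K: "?K \<in> borel_measurable (F (past t n))"
    unfolding proj_kernel_def
  proof (intro measurable_compose[OF _ Q_measurable] borel_measurable_add borel_measurable_sum
      borel_measurable_times borel_measurable_diff)
    fix u
    assume u: "u \<in> {t - int n<..t}"
    show "real_cond_exp M (F {u..t}) (X t) \<in> borel_measurable (F (past t n))"
      using u by (intro borel_measurable_noise_algebra_mono[OF borel_measurable_cond_exp]) auto
    show "real_cond_exp M (F {u + 1..t}) (X t) \<in> borel_measurable (F (past t n))"
      using u by (intro borel_measurable_noise_algebra_mono[OF borel_measurable_cond_exp]) auto
  qed simp_all
  have "(\<integral>\<^sup>+\<omega>. ennreal ((?K \<omega>)\<^sup>2) \<partial>M) < \<infinity>"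
    using ennreal_suminf_lessD[OF assms[unfolded sum_second_moments_def], of n] by simp
  then have "integrable M (\<lambda>\<omega>. (?K \<omega>)\<^sup>2)"
    by (rule iffD2[OF integrable_square_iff[OF F_measurable_M[OF K]]])
  then show ?thesis
    using K unfolding L2_def by blast
qed

text \<open>The equation presents \<open>X t\<close> as a mean square sum whose coefficients are the
  kernels themselves. Conditioning it shows that off one null set the kernels satisfy the recursion
  of \<open>g\<close>, which has only one solution.\<close>

lemma proj_kernel_eq_g:
  assumes "projective_solution M \<zeta> Q \<alpha> \<beta> \<mu> X" and "s \<le> t"
  shows "AE \<omega> in M. proj_kernel M \<zeta> Q \<alpha> \<beta> X s t \<omega> = g s t \<omega>"
proof -
  let ?K = "\<lambda>s. proj_kernel M \<zeta> Q \<alpha> \<beta> X s t"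
  have X: "X t \<in> borel_measurable M" "integrable M (\<lambda>\<omega>. (X t \<omega>)\<^sup>2)"
    using assms(1) F_measurable_M[of "X t" "{..t}"]
    unfolding projective_solution_def projective_process_def projective_with_coeffs_def by blast+
  have K: "sum_second_moments M t (\<lambda>s. ?K s) < \<infinity>"
    "ms_sum M t (\<lambda>s \<omega>. \<zeta> s \<omega> * ?K s \<omega>) (\<lambda>\<omega>. X t \<omega> - \<mu>)"
    using assms(1) unfolding projective_solution_def by blast+
  have "AE \<omega> in M. \<forall>n. ?K (t - int n) \<omega> =
      Q (\<alpha> n + (\<Sum>i<n. \<zeta> (t - int i) \<omega> * (\<beta> i (n - i) * ?K (t - int i) \<omega>)))"
    by (rule proj_kernel_ms_sum[where X = X, OF L2_proj_kernel[OF K(1)] X K(2)])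
  then have "AE \<omega> in M. \<forall>n. ?K (t - int n) \<omega> = g (t - int n) t \<omega>"
  proof (eventually_elim, intro allI)
    fix \<omega> n
    assume *: "\<forall>n. ?K (t - int n) \<omega> =
      Q (\<alpha> n + (\<Sum>i<n. \<zeta> (t - int i) \<omega> * (\<beta> i (n - i) * ?K (t - int i) \<omega>)))"
    show "?K (t - int n) \<omega> = g (t - int n) t \<omega>"
    proof (induction n rule: less_induct)
      case (less n)
      then show ?case
        unfolding g_rec[where t = t and n = n] *[rule_format, of n] by simp
    qed
  qed
  then show ?thesis
    using assms(2) by (auto elim!: eventually_mono dest: spec[of _ "nat (t - s)"])
qed

lemma projective_solution_ms_sum:
  assumes "projective_solution M \<zeta> Q \<alpha> \<beta> \<mu> X"
  shows "ms_sum M t (\<lambda>s \<omega>. \<zeta> s \<omega> * g s t \<omega>) (\<lambda>\<omega>. X t \<omega> - \<mu>)"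
proof -
  have "ms_sum M t (\<lambda>s \<omega>. \<zeta> s \<omega> * proj_kernel M \<zeta> Q \<alpha> \<beta> X s t \<omega>) (\<lambda>\<omega>. X t \<omega> - \<mu>)"
    using assms unfolding projective_solution_def by blast
  then show ?thesis
  proof (rule iffD1[OF ms_sum_AE_cong, rotated])
    show "AE \<omega> in M. \<zeta> s \<omega> * proj_kernel M \<zeta> Q \<alpha> \<beta> X s t \<omega> = \<zeta> s \<omega> * g s t \<omega>" if "s \<le> t" for s
      using proj_kernel_eq_g[OF assms that] by eventually_elim simp
  qed
qed

lemma projective_solution_second_moments:
  assumes "projective_solution M \<zeta> Q \<alpha> \<beta> \<mu> X"
  shows "(\<Sum>n. ennreal (coeff_moment t n)) < \<infinity>"
proof -
  have "sum_second_moments M t (\<lambda>s. proj_kernel M \<zeta> Q \<alpha> \<beta> X s t) < \<infinity>"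
    using assms unfolding projective_solution_def by blast
  moreover have "sum_second_moments M t (\<lambda>s. proj_kernel M \<zeta> Q \<alpha> \<beta> X s t) =
      sum_second_moments M t (\<lambda>s. g s t)"
    by (rule sum_second_moments_AE_cong) (rule proj_kernel_eq_g[OF assms])
  ultimately show ?thesis
    by (simp add: sum_second_moments_g)
qed

text \<open>A projective process is centred by its mean, the equation by \<open>\<mu>\<close>; the
  two agree because the noise terms do not contribute to the mean.\<close>

lemma projective_with_coeffs_g:
  assumes "\<And>t. X t \<in> borel_measurable (F {..t})"
    and "\<And>t. integrable M (\<lambda>\<omega>. (X t \<omega>)\<^sup>2)"
    and "\<And>t. (\<Sum>n. ennreal (coeff_moment t n)) < \<infinity>"
    and "\<And>t. ms_sum M t (\<lambda>s \<omega>. \<zeta> s \<omega> * g s t \<omega>) (\<lambda>\<omega>. X t \<omega> - \<mu>)"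
  shows "expectation (X t) = \<mu>" and "projective_with_coeffs M \<zeta> X g"
proof -
  show mean: "expectation (X t) = \<mu>" for t
    by (rule expectation_ms_sum[where f = "\<lambda>s. g s t", OF L2_g F_measurable_M[OF assms(1)] assms(2,4)])
  have meas: "g s t \<in> borel_measurable (F {s + 1..t})" if "s < t" for s t
    using g_measurable[of t "nat (t - s)"] that by simp
  have const: "\<exists>a. \<forall>\<omega>\<in>space M. g t t \<omega> = a" for t
    by simp
  have moments: "sum_second_moments M t (\<lambda>s. g s t) < \<infinity>" for t
    using assms(3) by (simp only: sum_second_moments_g)
  have sum: "ms_sum M t (\<lambda>s \<omega>. g s t \<omega> * \<zeta> s \<omega>) (\<lambda>\<omega>. X t \<omega> - expectation (X t))" for t
    using assms(4)[of t] by (simp only: mean mult.commute)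
  show "projective_with_coeffs M \<zeta> X g"
    unfolding projective_with_coeffs_def
    by (intro allI impI conjI assms(1,2) meas const moments sum) assumption
qed

lemma projective_solution_MA:
  assumes "projective_solution M \<zeta> Q \<alpha> \<beta> \<mu> X"
  shows "projective_MA_with_coeffs M \<zeta> X g"
proof -
  have X: "X t \<in> borel_measurable (F {..t})" "integrable M (\<lambda>\<omega>. (X t \<omega>)\<^sup>2)" for t
    using assms
    unfolding projective_solution_def projective_process_def projective_with_coeffs_def by blast+
  note * = projective_with_coeffs_g[OF X projective_solution_second_moments[OF assms]
      projective_solution_ms_sum[OF assms]]
  \<comment> \<open>\<open>h j\<close> reads its argument as the noise at times 1 to
    \<open>j\<close> and evaluates the coefficient at time \<open>j\<close> and lag
    \<open>j\<close>. By shift invariance coordinate \<open>i\<close> takes the place of the noise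
    at \<open>s + int i\<close>.\<close>
  define h :: "nat \<Rightarrow> (nat \<Rightarrow> real) \<Rightarrow> real" where
    "h j x = proj_coeff Q \<alpha> \<beta> (\<lambda>u. x (nat u)) (int j) j" for j x
  have "h j \<in> borel_measurable (\<Pi>\<^sub>M i\<in>{1..j}. borel)" for j
    unfolding h_def
  proof (rule measurable_proj_coeff[OF Q_measurable])
    fix i
    assume "i < j"
    then have "nat (int j - int i) \<in> {1..j}"
      by auto
    then show "(\<lambda>x. x (nat (int j - int i))) \<in> borel_measurable (\<Pi>\<^sub>M i\<in>{1..j}. borel)"
      by (rule measurable_component_singleton)
  qed
  moreover have "g s t \<omega> = h (nat (t - s)) (\<lambda>i\<in>{1..nat (t - s)}. \<zeta> (s + int i) \<omega>)"
    if "s < t" for s t \<omega>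
    unfolding h_def
  proof (rule proj_coeff_cong)
    fix i
    assume i: "i < nat (t - s)"
    then have "nat (int (nat (t - s)) - int i) \<in> {1..nat (t - s)}"
      by auto
    moreover have "s + int (nat (int (nat (t - s)) - int i)) = t - int i"
      using i by linarith
    ultimately show "\<zeta> (t - int i) \<omega> =
        (\<lambda>i\<in>{1..nat (t - s)}. \<zeta> (s + int i) \<omega>) (nat (int (nat (t - s)) - int i))"
      by (simp only: restrict_apply if_True)
  qed
  moreover have "\<exists>m. \<forall>t. expectation (X t) = m"
    using *(1) by blast
  ultimately show ?thesis
    unfolding projective_MA_with_coeffs_def using *(2)
    by (auto intro!: exI[of _ "Q (\<alpha> 0)"] exI[of _ h])
qed

section \<open>Existence, uniqueness and the linear case\<close>

text \<open>The coefficients \<open>g\<close> are explicit, so \<open>X t\<close> is taken to be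
  their mean square sum. Its kernels are \<open>Q\<close> applied to the sums in the recursion,
  hence equal to \<open>g\<close>, and the equation holds.\<close>

lemma projective_solution_exists:
  assumes "K_Q c \<alpha> \<beta> < \<infinity>"
  shows "\<exists>X. projective_solution M \<zeta> Q \<alpha> \<beta> \<mu> X"
proof -
  have fin: "(\<Sum>n. ennreal (coeff_moment t n)) < \<infinity>" for t
    using suminf_le_K_Q[of "coeff_moment t", OF coeff_moment_nonneg coeff_moment_le] assms by (rule le_less_trans)
  have summ: "summable (\<lambda>n. expectation (\<lambda>\<omega>. (g (t - int n) t \<omega>)\<^sup>2))" for t
    using summable_suminf_not_top[of "coeff_moment t", OF coeff_moment_nonneg] fin[of t] unfolding coeff_moment_def[abs_def] by simp
  \<comment> \<open>The kernel at time \<open>t\<close> involves \<open>X\<close> only at time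
    \<open>t\<close>, so the variables can be chosen separately for each \<open>t\<close>.\<close>
  define P where "P t Y \<longleftrightarrow> Y \<in> borel_measurable (F {..t}) \<and> integrable M (\<lambda>\<omega>. (Y \<omega>)\<^sup>2) \<and>
      ms_sum M t (\<lambda>s \<omega>. \<zeta> s \<omega> * g s t \<omega>) (\<lambda>\<omega>. Y \<omega> - \<mu>)" for t Y
  have "\<exists>Y. P t Y" for t
    by (rule ms_sum_exists[where f = "\<lambda>s. g s t", OF L2_g summ]) (auto simp: P_def)
  then have "\<exists>X. \<forall>t. P t (X t)"
    by (intro choice) blast
  then obtain X where X: "\<And>t. X t \<in> borel_measurable (F {..t})"
    "\<And>t. integrable M (\<lambda>\<omega>. (X t \<omega>)\<^sup>2)"
    "\<And>t. ms_sum M t (\<lambda>s \<omega>. \<zeta> s \<omega> * g s t \<omega>) (\<lambda>\<omega>. X t \<omega> - \<mu>)"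
    unfolding P_def by blast
  have kernel: "AE \<omega> in M. proj_kernel M \<zeta> Q \<alpha> \<beta> X s t \<omega> = g s t \<omega>" if "s \<le> t" for s t
  proof -
    have "AE \<omega> in M. \<forall>n. proj_kernel M \<zeta> Q \<alpha> \<beta> X (t - int n) t \<omega> =
        Q (\<alpha> n + (\<Sum>i<n. \<zeta> (t - int i) \<omega> * (\<beta> i (n - i) * g (t - int i) t \<omega>)))"
      by (rule proj_kernel_ms_sum[where f = "\<lambda>s. g s t" and t = t and X = X and c = \<mu>, OF L2_g F_measurable_M[OF X(1)] X(2,3)])
    then show ?thesis
    proof eventually_elim
      case (elim \<omega>)
      then have "proj_kernel M \<zeta> Q \<alpha> \<beta> X (t - int (nat (t - s))) t \<omega> = g (t - int (nat (t - s))) t \<omega>"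
        unfolding g_rec[where t = t and n = "nat (t - s)"] by blast
      then show ?case
        using that by simp
    qed
  qed
  have "sum_second_moments M t (\<lambda>s. proj_kernel M \<zeta> Q \<alpha> \<beta> X s t) < \<infinity>" for t
  proof -
    have "sum_second_moments M t (\<lambda>s. proj_kernel M \<zeta> Q \<alpha> \<beta> X s t) = sum_second_moments M t (\<lambda>s. g s t)"
      by (rule sum_second_moments_AE_cong) (rule kernel)
    then show ?thesis
      using fin[of t] by (simp only: sum_second_moments_g)
  qed
  moreover have "ms_sum M t (\<lambda>s \<omega>. \<zeta> s \<omega> * proj_kernel M \<zeta> Q \<alpha> \<beta> X s t \<omega>) (\<lambda>\<omega>. X t \<omega> - \<mu>)" for t
  proof (rule iffD2[OF ms_sum_AE_cong X(3)])
    show "AE \<omega> in M. \<zeta> s \<omega> * proj_kernel M \<zeta> Q \<alpha> \<beta> X s t \<omega> = \<zeta> s \<omega> * g s t \<omega>" if "s \<le> t" for s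
      using kernel[OF that] by eventually_elim simp
  qed
  moreover have "projective_process M \<zeta> X"
    unfolding projective_process_def by (rule exI, rule projective_with_coeffs_g(2)[OF X(1,2) fin X(3)])
  ultimately have "projective_solution M \<zeta> Q \<alpha> \<beta> \<mu> X"
    unfolding projective_solution_def by (intro conjI allI)
  then show ?thesis
    by (rule exI[of _ X])
qed

text \<open>Both are mean square sums of one and the same series, whose coefficients do not refer to
  the solution.\<close>

lemma projective_solution_unique:
  assumes X: "projective_solution M \<zeta> Q \<alpha> \<beta> \<mu> X" and Y: "projective_solution M \<zeta> Q \<alpha> \<beta> \<mu> Y"
  shows "AE \<omega> in M. X t \<omega> = Y t \<omega>"
proof -
  have meas: "Z t \<in> borel_measurable M" if "projective_solution M \<zeta> Q \<alpha> \<beta> \<mu> Z" for Z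
    using that F_measurable_M[of "Z t" "{..t}"]
    unfolding projective_solution_def projective_process_def projective_with_coeffs_def by blast
  have g: "(\<lambda>\<omega>. \<zeta> s \<omega> * g s t \<omega>) \<in> borel_measurable M" if "s \<le> t" for s
    using L2_measurable[OF L2_g[of t "nat (t - s)"]] that by simp
  have "AE \<omega> in M. X t \<omega> - \<mu> = Y t \<omega> - \<mu>"
    by (rule ms_sum_unique[OF _ _ g projective_solution_ms_sum[OF X] projective_solution_ms_sum[OF Y]])
      (use meas[OF X] meas[OF Y] in simp_all)
  then show ?thesis
    by eventually_elim simp
qed

text \<open>A solution has summable coefficient moments, and for linear \<open>Q\<close> their sum
  is \<open>K_Q\<close>. The time 0 is an arbitrary choice.\<close>

lemma K_Q_finite_if_linear:
  assumes "\<And>x. Q x = c * x" and "projective_solution M \<zeta> Q \<alpha> \<beta> \<mu> X"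
  shows "K_Q c \<alpha> \<beta> < \<infinity>"
  using projective_solution_second_moments[OF assms(2), of 0]
    suminf_eq_K_Q[of "coeff_moment 0" c \<alpha> \<beta>, OF coeff_moment_nonneg coeff_moment_eq[OF assms(1)]] by simp

end

theorem theorem4p3:
  fixes M :: "'a measure" and \<zeta> :: "int \<Rightarrow> 'a \<Rightarrow> real"
    and \<mu> c\<^sub>Q :: real and \<alpha> :: "nat \<Rightarrow> real" and \<beta> :: "nat \<Rightarrow> nat \<Rightarrow> real"
    and Q :: "real \<Rightarrow> real"
  assumes "prob_space M"
    and "std_iid M \<zeta>"
    and "Q \<in> borel_measurable borel"
    and "c\<^sub>Q > 0"
    and "\<And>x. \<bar>Q x\<bar> \<le> c\<^sub>Q * \<bar>x\<bar>"
  shows "(K_Q c\<^sub>Q \<alpha> \<beta> < \<infinity> \<longrightarrow>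
           (\<exists>X. projective_solution M \<zeta> Q \<alpha> \<beta> \<mu> X) \<and>
           (\<forall>X Y. projective_solution M \<zeta> Q \<alpha> \<beta> \<mu> X \<longrightarrow>
                  projective_solution M \<zeta> Q \<alpha> \<beta> \<mu> Y \<longrightarrow>
                  (\<forall>t. AE \<omega> in M. X t \<omega> = Y t \<omega>)) \<and>
           (\<forall>X. projective_solution M \<zeta> Q \<alpha> \<beta> \<mu> X \<longrightarrow>
              projective_MA_with_coeffs M \<zeta> X
                (\<lambda>s t \<omega>. proj_coeff Q \<alpha> \<beta> (\<lambda>u. \<zeta> u \<omega>) t (nat (t - s))) \<and>
              (\<forall>t. ms_sum M t
                     (\<lambda>s \<omega>. proj_coeff Q \<alpha> \<beta> (\<lambda>u. \<zeta> u \<omega>) t (nat (t - s)) * \<zeta> s \<omega>)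
                     (\<lambda>\<omega>. X t \<omega> - \<mu>)) \<and>
              (\<forall>t. ms_sum M t
                     (\<lambda>s \<omega>. \<zeta> s \<omega> *
                        volterra_G Q \<alpha> \<beta> t {s} (volterra_arg Q \<alpha> \<beta> (\<lambda>u. \<zeta> u \<omega>) t {s}))
                     (\<lambda>\<omega>. X t \<omega> - \<mu>)) \<and>
              (\<forall>t. ms_sum M (t - 3)
                     (\<lambda>s \<omega>. proj_coeff Q \<alpha> \<beta> (\<lambda>u. \<zeta> u \<omega>) t (nat (t - s)) * \<zeta> s \<omega>)
                     (\<lambda>\<omega>. X t \<omega> -
                        (\<mu> + Q (\<alpha> 0) * \<zeta> t \<omega>
                         + Q (\<alpha> 1 + \<beta> 0 1 * \<zeta> t \<omega> * Q (\<alpha> 0)) * \<zeta> (t - 1) \<omega>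
                         + Q (\<alpha> 2 + \<beta> 0 2 * \<zeta> t \<omega> * Q (\<alpha> 0)
                              + \<beta> 1 1 * \<zeta> (t - 1) \<omega> * Q (\<alpha> 1 + \<beta> 0 1 * \<zeta> t \<omega> * Q (\<alpha> 0)))
                           * \<zeta> (t - 2) \<omega>))))) \<and>
         ((\<forall>x. Q x = c\<^sub>Q * x) \<longrightarrow>
           (\<exists>X. projective_solution M \<zeta> Q \<alpha> \<beta> \<mu> X) \<longrightarrow>
           K_Q c\<^sub>Q \<alpha> \<beta> < \<infinity>)"
proof -
  interpret prob_space M
    by fact
  interpret projective_equation M \<zeta> Q \<alpha> \<beta> c\<^sub>Q \<mu>
    by unfold_locales (fact assms)+
  let ?sol = "projective_solution M \<zeta> Q \<alpha> \<beta> \<mu>"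
  have coeffs: "ms_sum M t (\<lambda>s \<omega>. g s t \<omega> * \<zeta> s \<omega>) (\<lambda>\<omega>. X t \<omega> - \<mu>)" if "?sol X" for X t
    using projective_solution_ms_sum[OF that, of t] by (simp only: mult.commute)
  \<comment> \<open>The two series agree term by term on every path.\<close>
  have volterra: "ms_sum M t (\<lambda>s \<omega>. \<zeta> s \<omega> *
      volterra_G Q \<alpha> \<beta> t {s} (volterra_arg Q \<alpha> \<beta> (\<lambda>u. \<zeta> u \<omega>) t {s})) (\<lambda>\<omega>. X t \<omega> - \<mu>)"
    if "?sol X" for X t
    using projective_solution_ms_sum[OF that, of t]
    by (rule iffD1[OF ms_sum_AE_cong, rotated]) (simp add: volterra_G_eq_proj_coeff)
  \<comment> \<open>The dots of the explicit expansion are read as the mean square sum of the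
    remaining terms over \<open>s \<le> t - 3\<close>.\<close>
  have tail: "ms_sum M (t - 3) (\<lambda>s \<omega>. g s t \<omega> * \<zeta> s \<omega>)
      (\<lambda>\<omega>. X t \<omega> -
         (\<mu> + Q (\<alpha> 0) * \<zeta> t \<omega>
          + Q (\<alpha> 1 + \<beta> 0 1 * \<zeta> t \<omega> * Q (\<alpha> 0)) * \<zeta> (t - 1) \<omega>
          + Q (\<alpha> 2 + \<beta> 0 2 * \<zeta> t \<omega> * Q (\<alpha> 0)
               + \<beta> 1 1 * \<zeta> (t - 1) \<omega> * Q (\<alpha> 1 + \<beta> 0 1 * \<zeta> t \<omega> * Q (\<alpha> 0)))
            * \<zeta> (t - 2) \<omega>))" if "?sol X" for X t
  proof -
    have "(\<Sum>i<3. g (t - int i) t \<omega> * \<zeta> (t - int i) \<omega>) =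
        Q (\<alpha> 0) * \<zeta> t \<omega>
        + Q (\<alpha> 1 + \<beta> 0 1 * \<zeta> t \<omega> * Q (\<alpha> 0)) * \<zeta> (t - 1) \<omega>
        + Q (\<alpha> 2 + \<beta> 0 2 * \<zeta> t \<omega> * Q (\<alpha> 0)
             + \<beta> 1 1 * \<zeta> (t - 1) \<omega> * Q (\<alpha> 1 + \<beta> 0 1 * \<zeta> t \<omega> * Q (\<alpha> 0)))
          * \<zeta> (t - 2) \<omega>" for \<omega>
      using sum_proj_coeff_3[of Q \<alpha> \<beta> "\<lambda>u. \<zeta> u \<omega>" t] by simp
    then show ?thesis
      using ms_sum_shift[OF coeffs[OF that], of t 3]
      by (simp only: diff_diff_eq add.assoc of_nat_numeral)
  qed
  show ?thesis
    by (intro conjI impI allI)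
      (use projective_solution_exists projective_solution_unique projective_solution_MA
        coeffs volterra tail K_Q_finite_if_linear in blast)+
qed

end
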